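(* For every integer $n\ge 1$, the bracket polynomial of the Celtic knot shadow $CK_4^{2n}$ is $$\langle CK_4^{2n}\rangle=\frac{1}{2q}\,(x^2+x)\left((x^2+2x+4+q)\left(\frac{p+q}{2}\right)^{n-1}-(x^2+2x+4-q)\left(\frac{p-q}{2}\right)^{n-1}\right),$$ where $p:=x^2+4x+4$ and $q:=\sqrt{x^4+4x^3+12x^2+20x+12}$ (the identity being understood in the quadratic extension of $\mathbb{Q}(x)$ obtained by adjoining $q$).
   Context: Bracket polynomial. A shadow diagram $D$ is a link projection (a 4-regular plane graph, possibly with disjoint simple closed curves) without over/under information, considered up to isotopy on the sphere. Each crossing can be smoothed in two ways (reconnecting its four ends into two non-crossing arcs). A state $S$ of $D$ is a choice of smoothing at every crossing; it yields $|S|$ disjoint circles. The bracket polynomial is $\langle D\rangle=\sum_S x^{|S|}\in\mathbb{Z}[x]$, the sum running over all states. Equivalently: $\langle\bigcirc\rangle=x$, $\langle\bigcirc\sqcup D'\rangle=x\langle D'\rangle$, and $\langle D\rangle$ is the sum of the brackets of the two diagrams obtained by smoothing one given crossing in the two ways. Celtic knot shadow $CK_4^{2n}$, $n\ge1$ (the barrier-free Celtic knot on a $4\times 2n$ grid of unit squares). Let the grid points be $(i,j)$ with row $0\le i\le 4$ (counted from the top downwards) and column $0\le j\le 2n$ (from left to right). Each unit square of the grid has exactly one diagonal joining two points with $i+j$ odd; $CK_4^{2n}$ is the union of these $8n$ diagonals. At each interior point $(i,j)$ with $1\le i\le 3$, $1\le j\le 2n-1$, $i+j$ odd, four diagonals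 meet and form a crossing ("the crossing at row $i$, column $j$"); at each boundary point with $i+j$ odd two diagonals meet and the curve simply turns there. Thus the crossings are at $(2,j)$ for odd $j$ and at $(1,j),(3,j)$ for even $j$, $1\le j\le 2n-1$, which gives $3n-2$ crossings. *)

theory Defs
  imports
    "HOL-Combinatorics.Orbits"
    "HOL-Algebra.Algebraic_Closure_Type"
begin

section \<open>Shadow diagrams and their bracket polynomial\<close>

text \<open>
  A shadow diagram is given as a rotation system, i.e. up to isotopy. The curve is cut into arcs by
  its crossings and, where convenient, by further points at which it merely passes through or turns.
  A dart is one of the two ends of an arc; \<open>mate\<close> sends it to the other end of the same arc,
  and \<open>rot\<close> to the next dart, in cyclic order, around the point where it is located.
  The points are thus the orbits of \<open>rot\<close>: those of size 4 are the crossings, those of size 2 the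
  points where the curve passes through. A disjoint simple closed curve is a component all of
  whose points have size 2.

  The bracket only uses these data. Being embedded in the sphere is a further property of the rotation
  system, which plays no part in the definition of the bracket.
\<close>

record 'd shadow =
  darts :: "'d set"
  mate :: "'d \<Rightarrow> 'd"
  rot :: "'d \<Rightarrow> 'd"

definition wf_shadow :: "('d, 'r) shadow_scheme \<Rightarrow> bool" where
  "wf_shadow D \<longleftrightarrow>
     finite (darts D) \<and>
     (\<forall>d\<in>darts D. mate D d \<in> darts D \<and> mate D d \<noteq> d \<and> mate D (mate D d) = d) \<and>
     (\<forall>d\<in>darts D. rot D d \<in> darts D \<and> card (orbit (rot D) d) \<in> {2, 4} \<and> d \<in> orbit (rot D) d)"

definition points :: "('d, 'r) shadow_scheme \<Rightarrow> 'd set set" where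
  "points D = orbit (rot D) ` darts D"

text \<open>
  A smoothing reconnects the darts at a point in pairs of cyclically adjacent darts. At a crossing,
  with darts \<open>a, b, c, d\<close> in cyclic order, this gives the two possibilities \<open>ab|cd\<close> and \<open>bc|da\<close>.
  At a point of size 2 it gives only the pair of the two darts present, so there is no choice.
\<close>

definition smoothings :: "('d, 'r) shadow_scheme \<Rightarrow> 'd set \<Rightarrow> 'd set set set" where
  "smoothings D P =
     (let r = rot D in {{{a, r a}, {r (r a), r (r (r a))}} | a. a \<in> P})"

definition states :: "('d, 'r) shadow_scheme \<Rightarrow> ('d set \<Rightarrow> 'd set set) set" where
  "states D = (\<Pi>\<^sub>E P\<in>points D. smoothings D P)"

definition joined :: "('d, 'r) shadow_scheme \<Rightarrow> ('d set \<Rightarrow> 'd set set) \<Rightarrow> 'd rel" where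
  "joined D S =
     {(a, mate D a) | a. a \<in> darts D} \<union>
     {(a, b). \<exists>P\<in>points D. \<exists>A\<in>S P. a \<in> A \<and> b \<in> A}"

definition circles :: "('d, 'r) shadow_scheme \<Rightarrow> ('d set \<Rightarrow> 'd set set) \<Rightarrow> 'd set set" where
  "circles D S = darts D // (joined D S)\<^sup>*"

definition bracket :: "('d, 'r) shadow_scheme \<Rightarrow> int poly" where
  "bracket D = (\<Sum>S\<in>states D. monom 1 (card (circles D S)))"


section \<open>The Celtic knot shadows\<close>

text \<open>
  Grid points are pairs (row, column), rows being counted downwards. The dart \<open>(u, v)\<close> is the end at
  \<open>u\<close> of the diagonal joining \<open>u\<close> and \<open>v\<close>.
\<close>

type_synonym grid_dart = "(int \<times> int) \<times> (int \<times> int)"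

definition celtic_points :: "nat \<Rightarrow> (int \<times> int) set" where
  "celtic_points n = {(i, j). 0 \<le> i \<and> i \<le> 4 \<and> 0 \<le> j \<and> j \<le> 2 * int n \<and> odd (i + j)}"

definition celtic_darts :: "nat \<Rightarrow> grid_dart set" where
  "celtic_darts n =
     {((i, j), (k, l)). (i, j) \<in> celtic_points n \<and> (k, l) \<in> celtic_points n \<and>
        \<bar>k - i\<bar> = 1 \<and> \<bar>l - j\<bar> = 1}"

text \<open>
  A clockwise quarter turn about the location of the dart: the direction of \<open>(u, v)\<close> passes through
  NW, NE, SE, SW, NW.
\<close>

fun quarter_turn :: "grid_dart \<Rightarrow> grid_dart" where
  "quarter_turn ((i, j), (k, l)) = ((i, j), (i + (l - j), j - (k - i)))"

text \<open>
  On the boundary of the grid only two (neighbouring) directions are present, and directions that are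
  absent are skipped.
\<close>

definition celtic_rot :: "nat \<Rightarrow> grid_dart \<Rightarrow> grid_dart" where
  "celtic_rot n d =
     (let e = quarter_turn d; f = quarter_turn e; g = quarter_turn f
      in if e \<in> celtic_darts n then e else if f \<in> celtic_darts n then f else g)"

definition celtic :: "nat \<Rightarrow> grid_dart shadow" where
  "celtic n = \<lparr>darts = celtic_darts n, mate = prod.swap, rot = celtic_rot n\<rparr>"

lemma orbit_2:
  assumes "f a = b" "f b = a"
  shows "orbit f a = {a, b}"
proof
  show "orbit f a \<subseteq> {a, b}"
  proof
    fix y assume "y \<in> orbit f a"
    then show "y \<in> {a, b}" by induction (use assms in auto)
  qed
  show "{a, b} \<subseteq> orbit f a"
    using assms orbit.base[of f a] orbit.step[of b f a] by auto
qed

lemma orbit_4: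
  assumes "f a = b" "f b = c" "f c = d" "f d = a"
  shows "orbit f a = {a, b, c, d}"
proof
  show "orbit f a \<subseteq> {a, b, c, d}"
  proof
    fix y assume "y \<in> orbit f a"
    then show "y \<in> {a, b, c, d}" by induction (use assms in auto)
  qed
  show "{a, b, c, d} \<subseteq> orbit f a"
    using assms orbit.base[of f a] orbit.step[of b f a] orbit.step[of c f a] orbit.step[of d f a]
    by auto
qed

lemma celtic_dart_cases:
  assumes "d \<in> celtic_darts n"
  obtains i j s t where "d = ((i, j), (i + s, j + t))" "s \<in> {-1, 1}" "t \<in> {-1, 1}"
    "0 \<le> i" "i \<le> 4" "0 \<le> j" "j \<le> 2 * int n" "odd (i + j)"
    "0 \<le> i + s" "i + s \<le> 4" "0 \<le> j + t" "j + t \<le> 2 * int n"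
proof -
  obtain i j k l where d: "d = ((i, j), (k, l))" by (metis prod.exhaust)
  show thesis
    by (rule that[of i j "k - i" "l - j"])
       (use assms in \<open>auto simp: d celtic_darts_def celtic_points_def\<close>)
qed

lemma celtic_dart_iff:
  assumes "s \<in> {-1, 1}" "t \<in> {-1, 1}" "0 \<le> i" "i \<le> 4" "0 \<le> j" "j \<le> 2 * int n" "odd (i + j)"
  shows "((i, j), (i + s, j + t)) \<in> celtic_darts n \<longleftrightarrow>
    0 \<le> i + s \<and> i + s \<le> 4 \<and> 0 \<le> j + t \<and> j + t \<le> 2 * int n"
  using assms by (auto simp: celtic_darts_def celtic_points_def)

lemma celtic_rot_cases:
  assumes d: "d = ((i, j), (i + s, j + t))" and st: "s \<in> {-1, 1}" "t \<in> {-1, 1}"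
    and b: "0 \<le> i" "i \<le> 4" "0 \<le> j" "j \<le> 2 * int n" "odd (i + j)"
    and b': "0 \<le> i + s" "i + s \<le> 4" "0 \<le> j + t" "j + t \<le> 2 * int n"
  shows "celtic_rot n d =
    (if i = 0 \<or> i = 4 then ((i, j), (i + s, j - t))
     else if j = 0 \<or> j = 2 * int n then ((i, j), (i - s, j + t))
     else ((i, j), (i + t, j - s)))"
proof -
  have q: "quarter_turn ((i, j), (i + s, j + t)) = ((i, j), (i + t, j + (- s)))" for s t
    by simp
  have st': "- s \<in> {-1, 1}" "- t \<in> {-1, 1}" using st by auto
  have par: "\<not> ((i = 0 \<or> i = 4) \<and> (j = 0 \<or> j = 2 * int n))"
    using b(5) by auto
  note iff = celtic_dart_iff[OF st(2) st'(1) b] celtic_dart_iff[OF st' b]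
  have rot_eq: "celtic_rot n d =
    (if 0 \<le> i + t \<and> i + t \<le> 4 \<and> 0 \<le> j + - s \<and> j + - s \<le> 2 * int n
     then ((i, j), (i + t, j + - s))
     else if 0 \<le> i + - s \<and> i + - s \<le> 4 \<and> 0 \<le> j + - t \<and> j + - t \<le> 2 * int n
     then ((i, j), (i + - s, j + - t))
     else ((i, j), (i + - t, j + - (- s))))"
    unfolding celtic_rot_def Let_def d q iff by (rule refl)
  consider "s = 1" "t = 1" | "s = 1" "t = -1" | "s = -1" "t = 1" | "s = -1" "t = -1"
    using st by auto
  then show ?thesis
  proof cases
    case 1
    show ?thesis unfolding rot_eq unfolding 1 using b b' par 1 by (simp split: if_split; presburger)
  next
    case 2
    show ?thesis unfolding rot_eq unfolding 2 using b b' par 2 by (simp split: if_split; presburger)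
  next
    case 3
    show ?thesis unfolding rot_eq unfolding 3 using b b' par 3 by (simp split: if_split; presburger)
  next
    case 4
    show ?thesis unfolding rot_eq unfolding 4 using b b' par 4 by (simp split: if_split; presburger)
  qed
qed

lemma wf_celtic: "wf_shadow (celtic n)"
proof -
  have fin: "finite (celtic_darts n)"
  proof (rule finite_subset)
    show "celtic_darts n \<subseteq> ({0..4} \<times> {0..2 * int n}) \<times> ({0..4} \<times> {0..2 * int n})"
      by (auto simp: celtic_darts_def celtic_points_def)
  qed auto
  have mate: "prod.swap d \<in> celtic_darts n \<and> prod.swap d \<noteq> d" if "d \<in> celtic_darts n" for d
  proof -
    obtain i j k l where d: "d = ((i, j), (k, l))" by (metis prod.exhaust)
    have *: "(i, j) \<in> celtic_points n" "(k, l) \<in> celtic_points n" "\<bar>k - i\<bar> = 1" "\<bar>l - j\<bar> = 1"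
      using that unfolding d celtic_darts_def by simp_all
    have "\<bar>i - k\<bar> = 1" "\<bar>j - l\<bar> = 1" "i \<noteq> k"
      using *(3,4) by linarith+
    with *(1,2) show ?thesis
      by (simp add: d celtic_darts_def)
  qed
  have rot: "celtic_rot n d \<in> celtic_darts n \<and> card (orbit (celtic_rot n) d) \<in> {2, 4} \<and>
      d \<in> orbit (celtic_rot n) d" if d: "d \<in> celtic_darts n" for d
  proof -
    obtain i j s t where d_eq: "d = ((i, j), (i + s, j + t))" and st: "s \<in> {-1, 1}" "t \<in> {-1, 1}"
      and b: "0 \<le> i" "i \<le> 4" "0 \<le> j" "j \<le> 2 * int n" "odd (i + j)"
      and b': "0 \<le> i + s" "i + s \<le> 4" "0 \<le> j + t" "j + t \<le> 2 * int n"
      using d by (rule celtic_dart_cases)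
    have st': "- s \<in> {-1, 1}" "- t \<in> {-1, 1}" using st by auto
    note r = celtic_rot_cases[OF refl _ _ b]
    have par: "\<not> ((i = 0 \<or> i = 4) \<and> (j = 0 \<or> j = 2 * int n))"
      using b(5) by auto
    consider (row) "i = 0 \<or> i = 4" | (column) "i \<noteq> 0" "i \<noteq> 4" "j = 0 \<or> j = 2 * int n"
      | (interior) "i \<noteq> 0" "i \<noteq> 4" "j \<noteq> 0" "j \<noteq> 2 * int n"
      by auto
    then show ?thesis
    proof cases
      case row
      let ?e = "((i, j), (i + s, j + (- t)))"
      have j: "0 < j" "j < 2 * int n" using row par b by auto
      have 1: "celtic_rot n d = ?e"
        using row r[OF st b'] by (simp add: d_eq)
      have 2: "celtic_rot n ?e = d"
        using row r[OF st(1) st'(2)] b' j st by (auto simp: d_eq)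
      have "?e \<in> celtic_darts n" "d \<noteq> ?e"
        using celtic_dart_iff[OF st(1) st'(2) b] b' j st by (auto simp: d_eq)
      with 1 2 show ?thesis by (simp add: orbit_2[OF 1 2])
    next
      case column
      let ?e = "((i, j), (i + (- s), j + t))"
      have i: "0 < i" "i < 4" using column b by auto
      have 1: "celtic_rot n d = ?e"
        using column r[OF st b'] by (simp add: d_eq)
      have 2: "celtic_rot n ?e = d"
        using column r[OF st'(1) st(2)] b' i st by (auto simp: d_eq)
      have "?e \<in> celtic_darts n" "d \<noteq> ?e"
        using celtic_dart_iff[OF st'(1) st(2) b] b' i st by (auto simp: d_eq)
      with 1 2 show ?thesis by (simp add: orbit_2[OF 1 2])
    next
      case interior
      have ij: "0 < i" "i < 4" "0 < j" "j < 2 * int n" using interior b by auto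
      let ?e = "((i, j), (i + t, j + (- s)))"
      let ?f = "((i, j), (i + (- s), j + (- t)))"
      let ?g = "((i, j), (i + (- t), j + s))"
      have step: "celtic_rot n ((i, j), (i + u, j + v)) = ((i, j), (i + v, j - u))"
        if "u \<in> {-1, 1}" "v \<in> {-1, 1}" for u v
        using r[OF that] interior that ij by auto
      have 1: "celtic_rot n d = ?e" using step[OF st] by (simp add: d_eq)
      have 2: "celtic_rot n ?e = ?f" using step[OF st(2) st'(1)] by simp
      have 3: "celtic_rot n ?f = ?g" using step[OF st'] by simp
      have 4: "celtic_rot n ?g = d" using step[OF st'(2) st(1)] by (simp add: d_eq)
      have "?e \<in> celtic_darts n"
        using celtic_dart_iff[OF st(2) st'(1) b] ij st by auto
      moreover have "card {d, ?e, ?f, ?g} = 4"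
      proof -
        consider "s = 1" "t = 1" | "s = 1" "t = -1" | "s = -1" "t = 1" | "s = -1" "t = -1"
          using st by auto
        then show ?thesis by cases (simp_all add: d_eq)
      qed
      ultimately show ?thesis
        using 1 by (simp add: orbit_4[OF 1 2 3 4])
    qed
  qed
  show ?thesis
    unfolding wf_shadow_def celtic_def using fin mate rot by simp
qed

end

theory Submission
  imports Defs
begin

text \<open>
  Cut the knot by a vertical line inside a column of squares: four strands are cut, and whatever
  smoothings have been chosen to the left, these are connected there in one of the two planar ways
  \<open>01|23\<close> and \<open>03|12\<close>. Passing a column of crossings acts on these two configurations by the
  Temperley-Lieb algebra on four strands with loop value \<open>x\<close>: by \<open>1 + U\<^sub>2\<close> for an odd column and by
  \<open>(1 + U\<^sub>1) (1 + U\<^sub>3)\<close> for an even one. The matrix of two consecutive columns has trace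
  \<open>p = x\<^sup>2 + 4 x + 4\<close> and determinant \<open>(x + 1)\<^sup>3\<close>, hence discriminant
  \<open>p\<^sup>2 - 4 (x + 1)\<^sup>3 = q\<^sup>2\<close> and eigenvalues \<open>(p + q) / 2\<close> and \<open>(p - q) / 2\<close>.
\<close>

section \<open>Smoothing one point at a time\<close>

text \<open>The number of circles of a state is global, so the part already smoothed is not
  summarised by a polynomial: it is kept as an equivalence relation \<open>R\<close> on darts whose
  classes are merged by each smoothing. A connection pattern at the cut and the number of classes of
  \<open>R\<close> determine the remaining sum; \<open>weight\<close> expresses this by quantifying
  over all \<open>R\<close> with a given pattern. Hence points are smoothed from left to right, but
  weights are computed from right to left. Absorbing a fresh arc or joining two unconnected strands
  loses one class, whereas joining two connected ends loses none. This difference is the source of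
  the loop value \<open>x\<close>. Since \<open>x\<close> need not be invertible, the deficit is
  carried as a factor \<open>x ^ K\<close> and cancelled only at the end. Planarity needs no
  topological argument: the left border produces \<open>01|23\<close>, and every cap used sends both
  planar patterns to a planar one, so \<open>02|13\<close> never arises.\<close>

definition link :: "'d rel \<Rightarrow> 'd \<Rightarrow> 'd \<Rightarrow> 'd rel" where
  "link R a b = (R \<union> {a, b} \<times> {a, b})\<^sup>*"

lemma equiv_rtrancl_eq:
  assumes "equiv UNIV R"
  shows "R\<^sup>* = R"
proof -
  have "Id \<subseteq> R" "trans R"
    using assms by (auto simp: equiv_def refl_on_def)
  then show ?thesis
    by (metis Un_absorb2 reflcl_trancl trancl_id Un_commute)
qed

text \<open>A chain that passes between the classes of \<open>a\<close> and \<open>b\<close> several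
  times can be shortened to at most one passage.\<close>

lemma link_iff:
  assumes "equiv UNIV R"
  shows "(u, v) \<in> link R a b \<longleftrightarrow>
    (u, v) \<in> R \<or> (u, a) \<in> R \<and> (b, v) \<in> R \<or> (u, b) \<in> R \<and> (a, v) \<in> R"
    (is "_ \<longleftrightarrow> ?P v")
proof
  have r: "(w, w) \<in> R" for w
    using assms by (auto simp: equiv_def refl_on_def)
  have s: "(w, z) \<in> R \<Longrightarrow> (z, w) \<in> R" for w z
    using assms by (meson equivE symE)
  have t: "(w, z) \<in> R \<Longrightarrow> (z, y) \<in> R \<Longrightarrow> (w, y) \<in> R" for w z y
    using assms by (meson equivE transE)
  show "?P v" if "(u, v) \<in> link R a b"
    using that unfolding link_def
  proof (induction rule: rtrancl_induct)
    case base
    then show ?case using r by blast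
  next
    case (step y z)
    then show ?case
      using r s t by blast
  qed
  have R: "(w, z) \<in> link R a b" if "(w, z) \<in> R" for w z
    using that unfolding link_def by blast
  have ab: "(a, b) \<in> link R a b" "(b, a) \<in> link R a b"
    unfolding link_def by blast+
  have T: "(w, z) \<in> link R a b \<Longrightarrow> (z, y) \<in> link R a b \<Longrightarrow> (w, y) \<in> link R a b" for w z y
    unfolding link_def by (rule rtrancl_trans)
  show "(u, v) \<in> link R a b" if "?P v"
    using that R ab T by meson
qed

lemma equiv_link:
  assumes "equiv UNIV R"
  shows "equiv UNIV (link R a b)"
proof (rule equivI)
  show "sym (link R a b)"
    using assms unfolding link_def
    by (intro sym_rtrancl sym_Un) (auto simp: equiv_def sym_def)
qed (simp_all add: link_def refl_rtrancl trans_rtrancl)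

lemma link_commute: "link R a b = link R b a"
  by (simp add: link_def insert_commute)

lemma link_absorb:
  assumes "equiv UNIV R" "(a, b) \<in> R"
  shows "link R a b = R"
proof -
  have "(w, w) \<in> R" for w
    using assms by (auto simp: equiv_def refl_on_def)
  moreover have s: "(b, a) \<in> R"
    using assms by (meson equivE symE)
  ultimately have "R \<union> {a, b} \<times> {a, b} = R"
    using assms(2) s by auto
  then show ?thesis
    by (simp add: link_def equiv_rtrancl_eq[OF assms(1)])
qed

text \<open>Two distinct classes are replaced by their union and all others survive, so merging
  costs exactly one class. The count is written as a sum because subtraction on \<open>nat\<close>
  truncates.\<close>

lemma card_quotient_link:
  assumes R: "equiv UNIV R" and "finite V" "a \<in> V" "b \<in> V"
  shows "card (V // R) = card (V // link R a b) + (if (a, b) \<in> R then 0 else 1)"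
proof (cases "(a, b) \<in> R")
  case True
  then show ?thesis by (simp add: link_absorb[OF R])
next
  case False
  let ?A = "R `` {a}" and ?B = "R `` {b}"
  have s: "(w, z) \<in> R \<Longrightarrow> (z, w) \<in> R" for w z
    using R by (meson equivE symE)
  have r: "(w, w) \<in> R" for w
    using assms by (auto simp: equiv_def refl_on_def)
  have eq: "R `` {w} = R `` {z} \<longleftrightarrow> (w, z) \<in> R" for w z
    using eq_equiv_class_iff[OF R] by simp
  have image: "link R a b `` {w} =
      (if (w, a) \<in> R \<or> (w, b) \<in> R then ?A \<union> ?B else R `` {w})" for w
  proof (cases "(w, a) \<in> R \<or> (w, b) \<in> R")
    case True
    then have "R `` {w} = ?A \<or> R `` {w} = ?B" by (simp add: eq)
    then show ?thesis using True False s by (auto simp: link_iff[OF R])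
  qed (auto simp: link_iff[OF R])
  have AB: "?A \<in> V // R" "?B \<in> V // R" "?A \<noteq> ?B"
    using assms(3,4) False by (simp_all add: quotientI eq)
  have fin: "finite (V // R)"
    using assms by (simp add: quotient_def)
  have "V // link R a b = insert (?A \<union> ?B) (V // R - {?A, ?B})"
  proof (intro equalityI subsetI)
    fix C assume "C \<in> V // link R a b"
    then obtain w where w: "w \<in> V" "C = link R a b `` {w}" by (auto elim: quotientE)
    then show "C \<in> insert (?A \<union> ?B) (V // R - {?A, ?B})"
      by (auto simp: image eq intro: quotientI split: if_splits)
  next
    fix C assume "C \<in> insert (?A \<union> ?B) (V // R - {?A, ?B})"
    then consider "C = ?A \<union> ?B" | w where "w \<in> V" "C = R `` {w}" "C \<noteq> ?A" "C \<noteq> ?B"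
      by (metis DiffE insertCI insertE quotientE)
    then show "C \<in> V // link R a b"
    proof cases
      case 1
      then have "C = link R a b `` {a}" by (simp add: image r)
      then show ?thesis using assms by (auto intro: quotientI)
    next
      case (2 w)
      then have "C = link R a b `` {w}" by (simp add: image eq)
      then show ?thesis using 2 by (auto intro: quotientI)
    qed
  qed
  \<comment> \<open>The insertion adds an element only if the union is not an old class; it contains
    \<open>a\<close> and \<open>b\<close>, which are unrelated in \<open>R\<close>.\<close>
  moreover have "?A \<union> ?B \<notin> V // R"
  proof
    assume "?A \<union> ?B \<in> V // R"
    then obtain w where "?A \<union> ?B = R `` {w}" by (auto elim: quotientE)
    then have "(w, a) \<in> R" "(w, b) \<in> R" using r by blast+
    then show False using False R s by (meson equivE transE)
  qed
  ultimately have "card (V // link R a b) = Suc (card (V // R) - 2)"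
    using fin AB by (simp add: card_Diff_subset)
  moreover have "card (V // R) \<ge> 2"
    using card_mono[OF fin, of "{?A, ?B}"] AB by simp
  ultimately show ?thesis using False by simp
qed

lemma rtrancl_Un_rtrancl_left: "(R\<^sup>* \<union> E)\<^sup>* = (R \<union> E)\<^sup>*"
  by (metis rtrancl_Un_rtrancl rtrancl_idemp)

text \<open>A smoothing contributes the square of each of its pairs. As \<open>link\<close> uses the
  same squares, smoothing a crossing amounts to two successive links.\<close>

lemma rtrancl_link_pair:
  "(R \<union> ({a, b} \<times> {a, b} \<union> {c, d} \<times> {c, d}))\<^sup>* = link (link R a b) c d"
  unfolding link_def rtrancl_Un_rtrancl_left Un_assoc by (rule refl)

lemma link_link_commute: "link (link R a b) c d = link (link R c d) a b"
  by (simp only: rtrancl_link_pair[symmetric] Un_commute)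

text \<open>Here \<open>R\<close> records the connections already made and \<open>Q\<close> the points still to be smoothed.\<close>

definition state_sum ::
  "('d, 'r) shadow_scheme \<Rightarrow> 'a::comm_ring_1 \<Rightarrow> 'd rel \<Rightarrow> 'd set set \<Rightarrow> 'a" where
  "state_sum D x R Q = (\<Sum>S\<in>(\<Pi>\<^sub>E P\<in>Q. smoothings D P).
     x ^ card (darts D // (R \<union> (\<Union>P\<in>Q. \<Union>A\<in>S P. A \<times> A))\<^sup>*))"

lemma state_sum_empty:
  "equiv UNIV R \<Longrightarrow> state_sum D x R {} = x ^ card (darts D // R)"
  by (simp add: state_sum_def equiv_rtrancl_eq)

lemma state_sum_rtrancl: "state_sum D x (R\<^sup>*) Q = state_sum D x R Q"
  by (simp add: state_sum_def rtrancl_Un_rtrancl_left)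

text \<open>A state on \<open>insert P Q\<close> is a free choice at \<open>P\<close> together with
  a state on \<open>Q\<close>, and the choice at \<open>P\<close> can be absorbed into the relation
  at once.\<close>

lemma state_sum_insert:
  assumes "P \<notin> Q"
  shows "state_sum D x R (insert P Q) =
    (\<Sum>s\<in>smoothings D P. state_sum D x ((R \<union> (\<Union>A\<in>s. A \<times> A))\<^sup>*) Q)"
proof -
  let ?E = "\<lambda>s::'a set set. \<Union>A\<in>s. A \<times> A"
  let ?T = "\<Pi>\<^sub>E P\<in>Q. smoothings D P"
  have inj: "inj_on (\<lambda>(s, S). S(P := s)) (smoothings D P \<times> ?T)"
    using assms by (rule inj_combinator)
  have "state_sum D x R (insert P Q) = (\<Sum>(s, S)\<in>smoothings D P \<times> ?T.
      x ^ card (darts D // (R \<union> (\<Union>P'\<in>insert P Q. ?E ((S(P := s)) P')))\<^sup>*))"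
    unfolding state_sum_def PiE_insert_eq
    by (subst sum.reindex[OF inj]) (simp add: case_prod_unfold)
  also have "\<dots> = (\<Sum>(s, S)\<in>smoothings D P \<times> ?T.
      x ^ card (darts D // ((R \<union> ?E s) \<union> (\<Union>P'\<in>Q. ?E (S P')))\<^sup>*))"
  proof (intro sum.cong refl)
    fix z assume "z \<in> smoothings D P \<times> ?T"
    obtain s S where z: "z = (s, S)" by fastforce
    have "(\<Union>P'\<in>insert P Q. ?E ((S(P := s)) P')) = ?E s \<union> (\<Union>P'\<in>Q. ?E (S P'))"
    proof -
      have "(\<Union>P'\<in>Q. ?E ((S(P := s)) P')) = (\<Union>P'\<in>Q. ?E (S P'))"
        using assms by (intro SUP_cong) auto
      then show ?thesis by simp
    qed
    then show "(case z of (s, S) \<Rightarrow>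
        x ^ card (darts D // (R \<union> (\<Union>P'\<in>insert P Q. ?E ((S(P := s)) P')))\<^sup>*)) =
      (case z of (s, S) \<Rightarrow> x ^ card (darts D // ((R \<union> ?E s) \<union> (\<Union>P'\<in>Q. ?E (S P')))\<^sup>*))"
      by (simp only: z prod.case Un_assoc)
  qed
  also have "\<dots> = (\<Sum>s\<in>smoothings D P. state_sum D x (R \<union> ?E s) Q)"
    by (simp add: state_sum_def sum.cartesian_product)
  finally show ?thesis
    by (simp add: state_sum_rtrancl)
qed

section \<open>Local rules at crossings and bends\<close>

definition crossing :: "('d, 'r) shadow_scheme \<Rightarrow> 'd \<Rightarrow> 'd \<Rightarrow> 'd \<Rightarrow> 'd \<Rightarrow> bool" where
  "crossing D a b c d \<longleftrightarrow> distinct [a, b, c, d] \<and>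
     rot D a = b \<and> rot D b = c \<and> rot D c = d \<and> rot D d = a"

definition bend :: "('d, 'r) shadow_scheme \<Rightarrow> 'd \<Rightarrow> 'd \<Rightarrow> bool" where
  "bend D a b \<longleftrightarrow> rot D a = b \<and> rot D b = a"

lemma smoothings_image:
  "smoothings D P = (\<lambda>a. {{a, rot D a}, {rot D (rot D a), rot D (rot D (rot D a))}}) ` P"
  by (simp add: smoothings_def Let_def Setcompr_eq_image)

lemma smoothings_crossing:
  assumes "crossing D a b c d"
  shows "smoothings D {a, b, c, d} = {{{a, b}, {c, d}}, {{b, c}, {d, a}}}"
proof -
  have "rot D a = b" "rot D b = c" "rot D c = d" "rot D d = a"
    using assms by (simp_all add: crossing_def)
  \<comment> \<open>Opposite starting darts yield the same smoothing, so the four instances collapse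
    to two.\<close>
  moreover have "{p, q, p, q} = {p, q}" for p q :: "'a set set"
    by auto
  ultimately show ?thesis
    by (simp add: smoothings_image insert_commute[of "{c, d}"] insert_commute[of "{d, a}"])
qed

text \<open>Rotating twice returns to the start, so the two pairs in the definition coincide, and
  either starting dart gives the same one.\<close>

lemma smoothings_bend:
  assumes "bend D a b"
  shows "smoothings D {a, b} = {{{a, b}}}"
  using assms by (simp add: smoothings_image bend_def insert_commute)

lemma state_sum_crossing:
  assumes "{a, b, c, d} \<notin> Q" "crossing D a b c d"
  shows "state_sum D x R (insert {a, b, c, d} Q) =
    state_sum D x (link (link R a b) c d) Q + state_sum D x (link (link R b c) d a) Q"
proof -
  \<comment> \<open>The sum ranges over a set of smoothings, so both terms are counted only because
    the two smoothings differ; distinctness of the darts ensures it.\<close>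
  have "{{a, b}, {c, d}} \<noteq> {{b, c}, {d, a}}"
    using assms(2) by (auto simp: crossing_def doubleton_eq_iff)
  then show ?thesis
    using assms(1) by (simp add: state_sum_insert smoothings_crossing[OF assms(2)]
        rtrancl_link_pair[symmetric] del: insert_Times_insert Un_insert_right)
qed

lemma state_sum_bend:
  assumes "{a, b} \<notin> Q" "bend D a b"
  shows "state_sum D x R (insert {a, b} Q) = state_sum D x (link R a b) Q"
  using assms by (simp add: state_sum_insert smoothings_bend link_def)

section \<open>Four strands\<close>

text \<open>
  Four strands end in the darts \<open>F 0, \<dots>, F 3\<close>; none of the arcs with darts in \<open>G\<close> has been linked
  to anything yet, and \<open>\<pi>\<close> labels the strands according to which of them are connected.
\<close>

definition frontier ::
  "('d, 'r) shadow_scheme \<Rightarrow> (nat \<Rightarrow> 'd) \<Rightarrow> 'd set \<Rightarrow> (nat \<Rightarrow> nat) \<Rightarrow> 'd rel \<Rightarrow> bool" where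
  "frontier D F G \<pi> R \<longleftrightarrow>
     equiv UNIV R \<and> G \<subseteq> darts D \<and>
     (\<forall>g\<in>G. mate D g \<in> G \<and> R `` {g} = {g, mate D g}) \<and>
     (\<forall>a<4. F a \<in> darts D - G) \<and>
     (\<forall>a<4. \<forall>b<4. (F a, F b) \<in> R \<longleftrightarrow> \<pi> a = \<pi> b)"

text \<open>
  The factor \<open>x ^ K\<close> compensates for the number of classes of \<open>R\<close> that disappear when the points in \<open>Q\<close>
  are smoothed, so that \<open>w\<close> does not depend on \<open>R\<close>.
\<close>

definition weight ::
  "('d, 'r) shadow_scheme \<Rightarrow> 'a::comm_ring_1 \<Rightarrow> nat \<Rightarrow> 'd set set \<Rightarrow> (nat \<Rightarrow> 'd) \<Rightarrow> 'd set \<Rightarrow> (nat \<Rightarrow> nat) \<Rightarrow> 'a \<Rightarrow> bool" where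
  "weight D x K Q F G \<pi> w \<longleftrightarrow>
     (\<forall>R. frontier D F G \<pi> R \<longrightarrow> x ^ K * state_sum D x R Q = x ^ card (darts D // R) * w)"

text \<open>The two planar ways of connecting four strands: \<open>01|23\<close> and \<open>03|12\<close>.\<close>

abbreviation "nested \<equiv> (\<lambda>a::nat. of_bool (a \<in> {1, 2}) :: nat)"
abbreviation "parallel \<equiv> (\<lambda>a::nat. a div 2)"

section \<open>Moving the frontier across one point\<close>

context
  fixes D :: "('d, 'r) shadow_scheme"
  assumes wf: "wf_shadow D"
begin

lemma finite_darts: "finite (darts D)"
  using wf by (simp add: wf_shadow_def)

lemma mate_props:
  assumes "d \<in> darts D"
  shows "mate D d \<in> darts D" "mate D d \<noteq> d" "mate D (mate D d) = d"
  using wf assms by (auto simp: wf_shadow_def)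

text \<open>Gluing a fresh arc to strand \<open>i\<close> only lengthens the strand: its end moves
  to \<open>mate D g\<close>, the pattern stays, and the isolated class of the arc is
  absorbed.\<close>

lemma frontier_extend:
  assumes fr: "frontier D F G \<pi> R" and i: "i < 4" and g: "g \<in> G"
  shows "frontier D (F(i := mate D g)) (G - {g, mate D g}) \<pi> (link R (F i) g)"
    and "card (darts D // R) = card (darts D // link R (F i) g) + 1"
proof -
  have R: "equiv UNIV R" and GV: "G \<subseteq> darts D"
    and G: "\<And>g. g \<in> G \<Longrightarrow> mate D g \<in> G" "\<And>g u. g \<in> G \<Longrightarrow> (g, u) \<in> R \<longleftrightarrow> u = g \<or> u = mate D g"
    and F: "\<And>a. a < 4 \<Longrightarrow> F a \<in> darts D" "\<And>a. a < 4 \<Longrightarrow> F a \<notin> G"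
    and \<pi>: "\<And>a b. a < 4 \<Longrightarrow> b < 4 \<Longrightarrow> (F a, F b) \<in> R \<longleftrightarrow> \<pi> a = \<pi> b"
    using fr by (auto simp: frontier_def)
  have s: "(u, v) \<in> R \<longleftrightarrow> (v, u) \<in> R" for u v
    using R by (meson equivE symE)
  have r: "(u, u) \<in> R" for u
    using R by (auto simp: equiv_def refl_on_def)
  note m = mate_props[of g]
  have gV: "g \<in> darts D" using g GV by auto
  have mm: "mate D (mate D d) = d" if "d \<in> G" for d
    using that GV mate_props by auto
  have GF: "(d, F a) \<notin> R" "(F a, d) \<notin> R" if "d \<in> G" "a < 4" for a d
    using G F that s by metis+
  show "frontier D (F(i := mate D g)) (G - {g, mate D g}) \<pi> (link R (F i) g)"
    unfolding frontier_def
  proof (intro conjI allI impI ballI)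
    show "equiv UNIV (link R (F i) g)" by (rule equiv_link[OF R])
    show "G - {g, mate D g} \<subseteq> darts D" using GV by auto
    fix d assume d: "d \<in> G - {g, mate D g}"
    have "mate D d \<noteq> g" "mate D d \<noteq> mate D g"
      using mm[of d] mm[OF g] d by auto
    then show "mate D d \<in> G - {g, mate D g}"
      using d G(1) by simp
    have "(d, g) \<notin> R"
      using d G(2)[of d g] mm[of d] by auto
    then have "(d, u) \<in> link R (F i) g \<longleftrightarrow> u = d \<or> u = mate D d" for u
      unfolding link_iff[OF R] using d GF(1)[of d i] i G(2)[of d u] by blast
    then show "link R (F i) g `` {d} = {d, mate D d}"
      by auto
  next
    fix a :: nat assume a: "a < 4"
    show "(F(i := mate D g)) a \<in> darts D - (G - {g, mate D g})"
      using a F m gV by auto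
    fix b :: nat assume b: "b < 4"
    have mg: "mate D g \<in> G" "(mate D g, g) \<in> R" "(g, mate D g) \<in> R"
      using g G mm by auto
    show "((F(i := mate D g)) a, (F(i := mate D g)) b) \<in> link R (F i) g \<longleftrightarrow> \<pi> a = \<pi> b"
      using a b i g mg GF \<pi> r by (auto simp: link_iff[OF R])
  qed
  show "card (darts D // R) = card (darts D // link R (F i) g) + 1"
    using card_quotient_link[OF R finite_darts F(1)[OF i] gV] GF g i by simp
qed

text \<open>This is the smoothing that turns back: strands \<open>i\<close> and \<open>j\<close> are
  joined on the left, and two fresh arcs form a new pair on the right. In \<open>\<pi>'\<close> the
  new pair is a block of its own, and the former partners of \<open>i\<close> and \<open>j\<close>
  become connected. The new pair costs one class; joining \<open>i\<close> and \<open>j\<close>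
  costs another unless they were connected, in which case a loop closes.\<close>

lemma frontier_cap:
  assumes fr: "frontier D F G \<pi> R" and ij: "i < 4" "j < 4" "i \<noteq> j"
    and g: "g \<in> G" "g' \<in> G" "g' \<noteq> g" "g' \<noteq> mate D g"
    and \<pi>': "\<And>a b. a < 4 \<Longrightarrow> b < 4 \<Longrightarrow> \<pi>' a = \<pi>' b \<longleftrightarrow>
      (if a \<in> {i, j} \<or> b \<in> {i, j} then a \<in> {i, j} \<and> b \<in> {i, j}
       else \<pi> a = \<pi> b \<or> {\<pi> a, \<pi> b} = {\<pi> i, \<pi> j})"
  shows "frontier D (F(i := mate D g, j := mate D g')) (G - {g, mate D g, g', mate D g'}) \<pi>'
      (link (link R (F i) (F j)) g g')"
    and "card (darts D // R) =
      card (darts D // link (link R (F i) (F j)) g g') + (if \<pi> i = \<pi> j then 1 else 2)"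
proof -
  let ?R = "link R (F i) (F j)"
  have R: "equiv UNIV R" and GV: "G \<subseteq> darts D"
    and G: "\<And>g. g \<in> G \<Longrightarrow> mate D g \<in> G" "\<And>g u. g \<in> G \<Longrightarrow> (g, u) \<in> R \<longleftrightarrow> u = g \<or> u = mate D g"
    and F: "\<And>a. a < 4 \<Longrightarrow> F a \<in> darts D" "\<And>a. a < 4 \<Longrightarrow> F a \<notin> G"
    and \<pi>: "\<And>a b. a < 4 \<Longrightarrow> b < 4 \<Longrightarrow> (F a, F b) \<in> R \<longleftrightarrow> \<pi> a = \<pi> b"
    using fr by (auto simp: frontier_def)
  note R' = equiv_link[OF R, of "F i" "F j"]
  have s: "(u, v) \<in> R \<longleftrightarrow> (v, u) \<in> R" for u v
    using R by (meson equivE symE)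
  have s': "(u, v) \<in> ?R \<longleftrightarrow> (v, u) \<in> ?R" for u v
    using R' by (meson equivE symE)
  have mm: "mate D (mate D d) = d" if "d \<in> G" for d
    using that GV mate_props by auto
  have GF: "(d, F a) \<notin> R" "(F a, d) \<notin> R" if "d \<in> G" "a < 4" for a d
    using G F that s by metis+
  have G': "(d, u) \<in> ?R \<longleftrightarrow> u = d \<or> u = mate D d" if "d \<in> G" for d u
    unfolding link_iff[OF R] using GF[OF that ij(1)] GF[OF that ij(2)] G(2)[OF that] by auto
  have GF': "(d, F a) \<notin> ?R" "(F a, d) \<notin> ?R" if "d \<in> G" "a < 4" for a d
    using G' G(1) F that s' by metis+
  have F': "(F a, F b) \<in> ?R \<longleftrightarrow> \<pi> a = \<pi> b \<or> {\<pi> a, \<pi> b} = {\<pi> i, \<pi> j}" if "a < 4" "b < 4" for a b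
    using that ij by (auto simp: link_iff[OF R] \<pi> doubleton_eq_iff)
  note mg = G(1)[OF g(1)] G(1)[OF g(2)]
  show "frontier D (F(i := mate D g, j := mate D g')) (G - {g, mate D g, g', mate D g'}) \<pi>'
      (link ?R g g')"
    unfolding frontier_def
  proof (intro conjI allI impI ballI)
    show "equiv UNIV (link ?R g g')" by (rule equiv_link[OF R'])
    show "G - {g, mate D g, g', mate D g'} \<subseteq> darts D" using GV by auto
    fix d assume d: "d \<in> G - {g, mate D g, g', mate D g'}"
    have "mate D d \<noteq> g" "mate D d \<noteq> mate D g" "mate D d \<noteq> g'" "mate D d \<noteq> mate D g'"
      using mm[of d] mm[OF g(1)] mm[OF g(2)] d by auto
    then show "mate D d \<in> G - {g, mate D g, g', mate D g'}"
      using d G(1) by simp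
    have "(d, g) \<notin> ?R" "(d, g') \<notin> ?R"
      using d G'[of d] mm[of d] by auto
    then have "(d, u) \<in> link ?R g g' \<longleftrightarrow> u = d \<or> u = mate D d" for u
      unfolding link_iff[OF R'] using d G'[of d u] by blast
    then show "link ?R g g' `` {d} = {d, mate D d}"
      by auto
  next
    fix a :: nat assume a: "a < 4"
    show "(F(i := mate D g, j := mate D g')) a \<in> darts D - (G - {g, mate D g, g', mate D g'})"
      using a F mg GV by auto
    fix b :: nat assume b: "b < 4"
    have *: "(mate D g, g) \<in> ?R" "(mate D g', g') \<in> ?R" "(g, mate D g) \<in> ?R" "(g', mate D g') \<in> ?R"
      "(mate D g, mate D g) \<in> ?R" "(mate D g', mate D g') \<in> ?R"
      using g mg G' mm by auto
    have "((F(i := mate D g, j := mate D g')) a, (F(i := mate D g, j := mate D g')) b) \<in> link ?R g g' \<longleftrightarrow>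
      (if a \<in> {i, j} \<or> b \<in> {i, j} then a \<in> {i, j} \<and> b \<in> {i, j} else (F a, F b) \<in> ?R)"
      using a b ij g mg * GF' by (auto simp: link_iff[OF R'])
    then show "((F(i := mate D g, j := mate D g')) a, (F(i := mate D g, j := mate D g')) b) \<in> link ?R g g'
        \<longleftrightarrow> \<pi>' a = \<pi>' b"
      using \<pi>'[OF a b] F'[OF a b] by simp
  qed
  have "(g, g') \<notin> ?R" using G' g by simp
  moreover have "g \<in> darts D" "g' \<in> darts D" using g GV by auto
  ultimately show "card (darts D // R) = card (darts D // link ?R g g') + (if \<pi> i = \<pi> j then 1 else 2)"
    using card_quotient_link[OF R finite_darts F(1) F(1), of i j] ij \<pi>[of i j]
      card_quotient_link[OF R' finite_darts, of g g'] by simp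
qed

lemma weight_bend:
  assumes "weight D x K Q (F(i := mate D g)) (G - {g, mate D g}) \<pi> w"
    and "i < 4" "g \<in> G" "bend D (F i) g" "{F i, g} \<notin> Q"
  shows "weight D x (K + 1) (insert {F i, g} Q) F G \<pi> w"
  unfolding weight_def
proof (intro allI impI)
  fix R assume R: "frontier D F G \<pi> R"
  note e = frontier_extend[OF R assms(2,3)]
  have "x ^ K * state_sum D x (link R (F i) g) Q = x ^ card (darts D // link R (F i) g) * w"
    using assms(1) e(1) by (simp add: weight_def)
  then show "x ^ (K + 1) * state_sum D x R (insert {F i, g} Q) = x ^ card (darts D // R) * w"
    unfolding e(2) state_sum_bend[OF assms(5,4)] by (simp add: mult.assoc)
qed

text \<open>Passing straight through loses two classes and keeps the pattern. Turning back loses two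
  as well, or only one if a loop closes; with the common deficit \<open>K + 2\<close> the spared
  class appears as the factor \<open>x\<close>.\<close>

lemma weight_crossing:
  assumes w: "weight D x K Q (F(i := mate D g, j := mate D g')) (G - {g, mate D g, g', mate D g'}) \<pi> w"
    and w': "weight D x K Q (F(i := mate D g, j := mate D g')) (G - {g, mate D g, g', mate D g'}) \<pi>' w'"
    and ij: "i < 4" "j < 4" "i \<noteq> j" and g: "g \<in> G" "g' \<in> G" "g' \<noteq> g" "g' \<noteq> mate D g"
    and P: "crossing D (F i) g g' (F j)" "{F i, g, g', F j} \<notin> Q"
    and \<pi>': "\<And>a b. a < 4 \<Longrightarrow> b < 4 \<Longrightarrow> \<pi>' a = \<pi>' b \<longleftrightarrow>
      (if a \<in> {i, j} \<or> b \<in> {i, j} then a \<in> {i, j} \<and> b \<in> {i, j}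
       else \<pi> a = \<pi> b \<or> {\<pi> a, \<pi> b} = {\<pi> i, \<pi> j})"
  shows "weight D x (K + 2) (insert {F i, g, g', F j} Q) F G \<pi> (w + (if \<pi> i = \<pi> j then x else 1) * w')"
  unfolding weight_def
proof (intro allI impI)
  fix R assume R: "frontier D F G \<pi> R"
  let ?n = "\<lambda>R. card (darts D // R)" and ?y = "if \<pi> i = \<pi> j then x else 1"
  let ?R = "link (link R (F i) g) g' (F j)" and ?R' = "link (link R g g') (F j) (F i)"
  \<comment> \<open>The crossing rule pairs the darts in cyclic order; the links are rearranged so
    that they involve strand ends first, as the frontier lemmas require.\<close>
  have R_eq: "?R = link (link R (F i) g) (F j) g'" by (rule link_commute)
  have R'_eq: "?R' = link (link R (F i) (F j)) g g'"
    by (simp only: link_link_commute[of R g] link_commute[of R "F j"])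
  note e = frontier_extend[OF R ij(1) g(1)]
  have g': "g' \<in> G - {g, mate D g}" using g by auto
  note e' = frontier_extend[OF e(1) ij(2) g']
  note c = frontier_cap[OF R ij g \<pi>']
  have "G - {g, mate D g} - {g', mate D g'} = G - {g, mate D g, g', mate D g'}" by auto
  then have fr: "frontier D (F(i := mate D g, j := mate D g')) (G - {g, mate D g, g', mate D g'}) \<pi> ?R"
    using e'(1) ij by (simp add: R_eq)
  have "?n R = ?n ?R + 2"
    using e(2) e'(2) ij by (simp add: R_eq)
  moreover have "x ^ K * state_sum D x ?R Q = x ^ ?n ?R * w"
    using w fr by (simp add: weight_def)
  ultimately have 1: "x ^ (K + 2) * state_sum D x ?R Q = x ^ ?n R * w"
    by (simp add: mult.assoc power_add mult.left_commute)
  have "?n R = ?n ?R' + (if \<pi> i = \<pi> j then 1 else 2)"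
    using c(2) by (simp add: R'_eq)
  moreover have "x ^ K * state_sum D x ?R' Q = x ^ ?n ?R' * w'"
    using w' c(1) by (simp add: weight_def R'_eq)
  ultimately have 2: "x ^ (K + 2) * state_sum D x ?R' Q = x ^ ?n R * (?y * w')"
    by (simp add: mult.assoc power_add mult.left_commute power2_eq_square)
  show "x ^ (K + 2) * state_sum D x R (insert {F i, g, g', F j} Q) = x ^ ?n R * (w + ?y * w')"
    unfolding state_sum_crossing[OF P(2,1)] distrib_left 1 2 ..
qed

text \<open>Closing up \<open>01|23\<close> merges nothing, while closing up \<open>03|12\<close>
  merges two classes into one. The deficit 1 is what the latter needs, which leaves a factor
  \<open>x\<close> for the former.\<close>

lemma weight_end:
  assumes "bend D (F 0) (F 1)" "bend D (F 2) (F 3)" "{F 0, F 1} \<noteq> {F 2, F 3}"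
  shows "weight D x 1 {{F 0, F 1}, {F 2, F 3}} F G parallel x"
    and "weight D x 1 {{F 0, F 1}, {F 2, F 3}} F G nested 1"
proof -
  let ?n = "\<lambda>R. card (darts D // R)" and ?L = "\<lambda>R. link (link R (F 0) (F 1)) (F 2) (F 3)"
  have Z: "state_sum D x R {{F 0, F 1}, {F 2, F 3}} = x ^ ?n (?L R)" if "equiv UNIV R" for R
    using assms that by (simp add: state_sum_bend state_sum_empty equiv_link)
  show "weight D x 1 {{F 0, F 1}, {F 2, F 3}} F G parallel x"
    unfolding weight_def
  proof (intro allI impI)
    fix R assume fr: "frontier D F G parallel R"
    then have R: "equiv UNIV R" by (simp add: frontier_def)
    have F: "(F a, F b) \<in> R \<longleftrightarrow> a div 2 = b div 2" if "a < 4" "b < 4" for a b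
      using fr that by (simp add: frontier_def)
    have "?L R = R"
      using F[of 0 1] F[of 2 3] by (simp add: link_absorb[OF R])
    then show "x ^ 1 * state_sum D x R {{F 0, F 1}, {F 2, F 3}} = x ^ ?n R * x"
      unfolding Z[OF R] by simp
  qed
  show "weight D x 1 {{F 0, F 1}, {F 2, F 3}} F G nested 1"
    unfolding weight_def
  proof (intro allI impI)
    fix R assume fr: "frontier D F G nested R"
    then have R: "equiv UNIV R" and V: "\<And>a. a < 4 \<Longrightarrow> F a \<in> darts D" by (auto simp: frontier_def)
    have F: "(F a, F b) \<in> R \<longleftrightarrow> (a \<in> {1, 2} \<longleftrightarrow> b \<in> {1, 2})" if "a < 4" "b < 4" for a b
      using fr that by (simp add: frontier_def)
    have "(F 2, F 3) \<in> link R (F 0) (F 1)"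
      using F[of 2 1] F[of 0 3] by (simp add: link_iff[OF R])
    then have "?L R = link R (F 0) (F 1)"
      by (rule link_absorb[OF equiv_link[OF R]])
    moreover have "?n R = ?n (link R (F 0) (F 1)) + 1"
      using card_quotient_link[OF R finite_darts V[of 0] V[of 1]] F[of 0 1] by simp
    ultimately show "x ^ 1 * state_sum D x R {{F 0, F 1}, {F 2, F 3}} = x ^ ?n R * 1"
      unfolding Z[OF R] by simp
  qed
qed

end

text \<open>Frontiers built by function updates agree with \<open>mate D \<circ> g\<close> only on
  the four strands, so they are not equal as functions.\<close>

lemma weight_cong:
  assumes "\<And>a. a < 4 \<Longrightarrow> F a = F' a"
  shows "weight D x K Q F G \<pi> w = weight D x K Q F' G \<pi> w"
proof -
  have "frontier D F G \<pi> = frontier D F' G \<pi>"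
    using assms by (simp add: frontier_def fun_eq_iff)
  then show ?thesis by (simp only: weight_def)
qed

lemma less_4_cases:
  assumes "(a::nat) < 4"
  obtains "a = 0" | "a = 1" | "a = 2" | "a = 3"
  using assms by linarith

text \<open>Capping the middle strands makes either pattern \<open>nested\<close>: from
  \<open>parallel\<close>, the partners 0 and 3 get connected; from \<open>nested\<close>, they
  already were.\<close>

lemma cap_1_2:
  shows "(a::nat) < 4 \<Longrightarrow> b < 4 \<Longrightarrow> nested a = nested b \<longleftrightarrow>
    (if a \<in> {1, 2} \<or> b \<in> {1, 2} then a \<in> {1, 2} \<and> b \<in> {1, 2}
     else parallel a = parallel b \<or> {parallel a, parallel b} = {parallel 1, parallel 2})"
  and "(a::nat) < 4 \<Longrightarrow> b < 4 \<Longrightarrow> nested a = nested b \<longleftrightarrow>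
    (if a \<in> {1, 2} \<or> b \<in> {1, 2} then a \<in> {1, 2} \<and> b \<in> {1, 2}
     else nested a = nested b \<or> {nested a, nested b} = {nested 1, nested 2})"
  by (elim less_4_cases; simp add: doubleton_eq_iff)+

lemma cap_2_3:
  shows "(a::nat) < 4 \<Longrightarrow> b < 4 \<Longrightarrow> parallel a = parallel b \<longleftrightarrow>
    (if a \<in> {2, 3} \<or> b \<in> {2, 3} then a \<in> {2, 3} \<and> b \<in> {2, 3}
     else parallel a = parallel b \<or> {parallel a, parallel b} = {parallel 2, parallel 3})"
  and "(a::nat) < 4 \<Longrightarrow> b < 4 \<Longrightarrow> parallel a = parallel b \<longleftrightarrow>
    (if a \<in> {2, 3} \<or> b \<in> {2, 3} then a \<in> {2, 3} \<and> b \<in> {2, 3}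
     else nested a = nested b \<or> {nested a, nested b} = {nested 2, nested 3})"
  by (elim less_4_cases; simp add: doubleton_eq_iff)+

lemma cap_0_1:
  shows "(a::nat) < 4 \<Longrightarrow> b < 4 \<Longrightarrow> parallel a = parallel b \<longleftrightarrow>
    (if a \<in> {0, 1} \<or> b \<in> {0, 1} then a \<in> {0, 1} \<and> b \<in> {0, 1}
     else parallel a = parallel b \<or> {parallel a, parallel b} = {parallel 0, parallel 1})"
  and "(a::nat) < 4 \<Longrightarrow> b < 4 \<Longrightarrow> parallel a = parallel b \<longleftrightarrow>
    (if a \<in> {0, 1} \<or> b \<in> {0, 1} then a \<in> {0, 1} \<and> b \<in> {0, 1}
     else nested a = nested b \<or> {nested a, nested b} = {nested 0, nested 1})"
  by (elim less_4_cases; simp add: doubleton_eq_iff)+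

section \<open>Transfer across a whole column\<close>

context
  fixes D :: "('d, 'r) shadow_scheme" and x :: "'a::comm_ring_1"
  assumes wf: "wf_shadow D"
begin

text \<open>Only the middle crossing offers a choice. Its cap turns \<open>parallel\<close> into
  \<open>nested\<close> without a loop, giving \<open>a + b\<close>; applied to
  \<open>nested\<close> it closes a loop, giving \<open>1 + x\<close>.\<close>

lemma weight_odd_column:
  assumes g: "\<And>a. a < 4 \<Longrightarrow> g a \<in> G" "inj_on g {..<4}" "\<And>a b. a < 4 \<Longrightarrow> b < 4 \<Longrightarrow> g a \<noteq> mate D (g b)"
    and P: "bend D (F 0) (g 0)" "crossing D (F 1) (g 1) (g 2) (F 2)" "bend D (F 3) (g 3)"
    and Q: "{F 0, g 0} \<notin> insert {F 1, g 1, g 2, F 2} (insert {F 3, g 3} Q)"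
      "{F 1, g 1, g 2, F 2} \<notin> insert {F 3, g 3} Q" "{F 3, g 3} \<notin> Q"
    and a: "weight D x K Q (mate D \<circ> g) (G - g ` {..<4} - mate D ` g ` {..<4}) parallel a"
    and b: "weight D x K Q (mate D \<circ> g) (G - g ` {..<4} - mate D ` g ` {..<4}) nested b"
  defines "Q' \<equiv> insert {F 0, g 0} (insert {F 1, g 1, g 2, F 2} (insert {F 3, g 3} Q))"
  shows "weight D x (K + 4) Q' F G parallel (a + b)"
    and "weight D x (K + 4) Q' F G nested ((1 + x) * b)"
proof -
  \<comment> \<open>The frontiers are named in the order in which the points are smoothed; the
    weights are then derived in the opposite order, starting from \<open>Q\<close>.\<close>
  let ?F1 = "F(0 := mate D (g 0))" and ?G1 = "G - {g 0, mate D (g 0)}"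
  let ?F2 = "?F1(1 := mate D (g 1), 2 := mate D (g 2))"
  let ?G2 = "?G1 - {g 1, mate D (g 1), g 2, mate D (g 2)}"
  let ?F3 = "?F2(3 := mate D (g 3))" and ?G3 = "?G2 - {g 3, mate D (g 3)}"
  have F: "weight D x K Q (mate D \<circ> g) H \<pi> w = weight D x K Q ?F3 H \<pi> w" for H \<pi> w
    by (rule weight_cong) (auto elim!: less_4_cases)
  have "{..<4} = {0, 1, 2, 3::nat}" by auto
  then have G: "G - g ` {..<4} - mate D ` g ` {..<4} = ?G3" by auto
  have ne: "g a \<noteq> g b" if "a \<noteq> b" "a < 4" "b < 4" for a b
    using that g(2) by (auto simp: inj_on_def)
  have g1: "g 1 \<in> ?G1" "g 2 \<in> ?G1" "g 3 \<in> ?G2"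
    using g(1,3) ne by auto
  have 3: "weight D x (K + 1) (insert {F 3, g 3} Q) ?F2 ?G2 \<pi> w"
    if "weight D x K Q ?F3 ?G3 \<pi> w" for \<pi> w
    using weight_bend[OF wf that] g1(3) P(3) Q(3) by simp
  note a3 = 3[OF a[unfolded F G]] and b3 = 3[OF b[unfolded F G]]
  have c: "crossing D (?F1 1) (g 1) (g 2) (?F1 2)" using P(2) by simp
  have Q2: "{?F1 1, g 1, g 2, ?F1 2} \<notin> insert {F 3, g 3} Q" using Q(2) by simp
  have "weight D x (K + 1 + 2) (insert {?F1 1, g 1, g 2, ?F1 2} (insert {F 3, g 3} Q)) ?F1 ?G1 parallel
      (a + (if parallel 1 = parallel 2 then x else 1) * b)"
    by (rule weight_crossing[OF wf a3 b3 _ _ _ g1(1,2) _ _ c Q2 cap_1_2(1)])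
       (use g(3) ne in simp_all)
  then have a2: "weight D x (K + 3) (insert {F 1, g 1, g 2, F 2} (insert {F 3, g 3} Q)) ?F1 ?G1 parallel (a + b)"
    by (simp add: numeral_eq_Suc)
  have "weight D x (K + 1 + 2) (insert {?F1 1, g 1, g 2, ?F1 2} (insert {F 3, g 3} Q)) ?F1 ?G1 nested
      (b + (if nested 1 = nested 2 then x else 1) * b)"
    by (rule weight_crossing[OF wf b3 b3 _ _ _ g1(1,2) _ _ c Q2 cap_1_2(2)])
       (use g(3) ne in simp_all)
  then have b2: "weight D x (K + 3) (insert {F 1, g 1, g 2, F 2} (insert {F 3, g 3} Q)) ?F1 ?G1 nested
      ((1 + x) * b)"
    by (simp add: numeral_eq_Suc distrib_right)
  show "weight D x (K + 4) Q' F G parallel (a + b)"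
    using weight_bend[OF wf a2 _ g(1) P(1) Q(1)] by (simp add: Q'_def numeral_eq_Suc)
  show "weight D x (K + 4) Q' F G nested ((1 + x) * b)"
    using weight_bend[OF wf b2 _ g(1) P(1) Q(1)] by (simp add: Q'_def numeral_eq_Suc)
qed

text \<open>On \<open>parallel\<close> each of the two caps closes a loop. On \<open>nested\<close>,
  no cap gives \<open>b\<close>, either single cap gives \<open>a\<close>, and both together give
  \<open>x * a\<close>, because the second one closes a loop.\<close>

lemma weight_even_column:
  assumes g: "\<And>a. a < 4 \<Longrightarrow> g a \<in> G" "inj_on g {..<4}" "\<And>a b. a < 4 \<Longrightarrow> b < 4 \<Longrightarrow> g a \<noteq> mate D (g b)"
    and P: "crossing D (F 0) (g 0) (g 1) (F 1)" "crossing D (F 2) (g 2) (g 3) (F 3)"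
    and Q: "{F 0, g 0, g 1, F 1} \<notin> insert {F 2, g 2, g 3, F 3} Q" "{F 2, g 2, g 3, F 3} \<notin> Q"
    and a: "weight D x K Q (mate D \<circ> g) (G - g ` {..<4} - mate D ` g ` {..<4}) parallel a"
    and b: "weight D x K Q (mate D \<circ> g) (G - g ` {..<4} - mate D ` g ` {..<4}) nested b"
  defines "Q' \<equiv> insert {F 0, g 0, g 1, F 1} (insert {F 2, g 2, g 3, F 3} Q)"
  shows "weight D x (K + 4) Q' F G parallel ((1 + x)\<^sup>2 * a)"
    and "weight D x (K + 4) Q' F G nested (b + (2 + x) * a)"
proof -
  let ?F1 = "F(0 := mate D (g 0), 1 := mate D (g 1))"
  let ?G1 = "G - {g 0, mate D (g 0), g 1, mate D (g 1)}"
  let ?F2 = "?F1(2 := mate D (g 2), 3 := mate D (g 3))"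
  let ?G2 = "?G1 - {g 2, mate D (g 2), g 3, mate D (g 3)}"
  have F: "weight D x K Q (mate D \<circ> g) H \<pi> w = weight D x K Q ?F2 H \<pi> w" for H \<pi> w
    by (rule weight_cong) (auto elim!: less_4_cases)
  have "{..<4} = {0, 1, 2, 3::nat}" by auto
  then have G: "G - g ` {..<4} - mate D ` g ` {..<4} = ?G2" by auto
  have ne: "g a \<noteq> g b" if "a \<noteq> b" "a < 4" "b < 4" for a b
    using that g(2) by (auto simp: inj_on_def)
  have g1: "g 2 \<in> ?G1" "g 3 \<in> ?G1"
    using g(1,3) ne by auto
  note a' = a[unfolded F G] and b' = b[unfolded F G]
  have c: "crossing D (?F1 2) (g 2) (g 3) (?F1 3)" using P(2) by simp
  have Q2: "{?F1 2, g 2, g 3, ?F1 3} \<notin> Q" using Q(2) by simp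
  let ?Q = "insert {F 2, g 2, g 3, F 3} Q"
  have "weight D x (K + 2) (insert {?F1 2, g 2, g 3, ?F1 3} Q) ?F1 ?G1 parallel
      (a + (if parallel 2 = parallel 3 then x else 1) * a)"
    by (rule weight_crossing[OF wf a' a' _ _ _ g1 _ _ c Q2 cap_2_3(1)])
       (use g(3) ne in simp_all)
  then have a2: "weight D x (K + 2) ?Q ?F1 ?G1 parallel ((1 + x) * a)"
    by (simp add: distrib_right)
  have "weight D x (K + 2) (insert {?F1 2, g 2, g 3, ?F1 3} Q) ?F1 ?G1 nested
      (b + (if nested 2 = nested 3 then x else 1) * a)"
    by (rule weight_crossing[OF wf b' a' _ _ _ g1 _ _ c Q2 cap_2_3(2)])
       (use g(3) ne in simp_all)
  then have b2: "weight D x (K + 2) ?Q ?F1 ?G1 nested (b + a)"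
    by simp
  have "weight D x (K + 2 + 2) Q' F G parallel
      ((1 + x) * a + (if parallel 0 = parallel 1 then x else 1) * ((1 + x) * a))"
    unfolding Q'_def
    by (rule weight_crossing[OF wf a2 a2 _ _ _ _ _ _ _ P(1) Q(1) cap_0_1(1)])
       (use g(1,3) ne in simp_all)
  moreover have "K + 2 + 2 = K + 4" by simp
  ultimately show "weight D x (K + 4) Q' F G parallel ((1 + x)\<^sup>2 * a)"
    by (simp only: power2_eq_square) (simp add: algebra_simps)
  have "weight D x (K + 2 + 2) Q' F G nested
      (b + a + (if nested 0 = nested 1 then x else 1) * ((1 + x) * a))"
    unfolding Q'_def
    by (rule weight_crossing[OF wf b2 a2 _ _ _ _ _ _ _ P(1) Q(1) cap_0_1(2)])
       (use g(1,3) ne in simp_all)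
  moreover have "(b + a) + (1 + x) * a = b + (2 + x) * a"
    by (simp add: algebra_simps)
  ultimately show "weight D x (K + 4) Q' F G nested (b + (2 + x) * a)"
    by (simp add: numeral_eq_Suc)
qed

end

section \<open>The columns of the Celtic knot\<close>

text \<open>
  \<open>rightward i j\<close> is the left end of the diagonal of the unit square with top left corner \<open>(i, j)\<close>;
  \<open>leftward i j\<close> is the right end of the diagonal of the square to the left of that one. So the darts
  in column \<open>j\<close> are \<open>leftward i j\<close> and \<open>rightward i j\<close> for \<open>0 \<le> i < 4\<close>.
\<close>

definition rightward :: "int \<Rightarrow> int \<Rightarrow> grid_dart" where
  "rightward i j =
     (if even (i + j) then ((i + 1, j), (i, j + 1)) else ((i, j), (i + 1, j + 1)))"

definition leftward :: "int \<Rightarrow> int \<Rightarrow> grid_dart" where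
  "leftward i j = prod.swap (rightward i (j - 1))"

definition darts_at :: "nat \<Rightarrow> int \<times> int \<Rightarrow> grid_dart set" where
  "darts_at n u = {d \<in> celtic_darts n. fst d = u}"

definition points_from :: "nat \<Rightarrow> int \<Rightarrow> grid_dart set set" where
  "points_from n m = darts_at n ` {u \<in> celtic_points n. m \<le> snd u}"

text \<open>Both ends are bounded, so that the set consists of whole diagonals: those not yet
  reached when column \<open>m\<close> is about to be smoothed.\<close>

definition darts_from :: "nat \<Rightarrow> int \<Rightarrow> grid_dart set" where
  "darts_from n m = {d \<in> celtic_darts n. m \<le> snd (fst d) \<and> m \<le> snd (snd d)}"

lemma celtic_simps [simp]:
  "darts (celtic n) = celtic_darts n" "mate (celtic n) = prod.swap" "rot (celtic n) = celtic_rot n"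
  by (simp_all add: celtic_def)

lemma abs_eq_1_iff: "\<bar>k - i\<bar> = 1 \<longleftrightarrow> k = i - 1 \<or> k = i + (1::int)"
  by linarith

lemma darts_at_eq:
  assumes "(i, j) \<in> celtic_points n"
  shows "darts_at n (i, j) = (\<Union>(k, l)\<in>{(i - 1, j - 1), (i - 1, j + 1), (i + 1, j + 1), (i + 1, j - 1)}.
    if 0 \<le> k \<and> k \<le> 4 \<and> 0 \<le> l \<and> l \<le> 2 * int n then {((i, j), (k, l))} else {})"
proof -
  have b: "0 \<le> i" "i \<le> 4" "0 \<le> j" "j \<le> 2 * int n" "odd (i + j)"
    using assms by (auto simp: celtic_points_def)
  have iff: "((i, j), (k, l)) \<in> celtic_darts n \<longleftrightarrow> (k = i - 1 \<or> k = i + 1) \<and> (l = j - 1 \<or> l = j + 1) \<and>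
      0 \<le> k \<and> k \<le> 4 \<and> 0 \<le> l \<and> l \<le> 2 * int n" for k l
  proof -
    have "odd (k + l)" if "k = i - 1 \<or> k = i + 1" "l = j - 1 \<or> l = j + 1"
      using that b(5) by presburger
    then show ?thesis
      using assms unfolding celtic_darts_def celtic_points_def abs_eq_1_iff by blast
  qed
  have "darts_at n (i, j) = {d. \<exists>k l. d = ((i, j), (k, l)) \<and> ((i, j), (k, l)) \<in> celtic_darts n}"
    by (auto simp: darts_at_def)
  then show ?thesis
    unfolding iff by (auto split: if_splits)
qed

lemma celtic_pointsI:
  "0 \<le> i \<Longrightarrow> i \<le> 4 \<Longrightarrow> 0 \<le> j \<Longrightarrow> j \<le> 2 * int n \<Longrightarrow> odd (i + j) \<Longrightarrow> (i, j) \<in> celtic_points n"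
  by (simp add: celtic_points_def)

section \<open>Rotation and darts at the three kinds of grid points\<close>

lemma celtic_rot_interior:
  assumes "0 < i" "i < 4" "0 < j" "j < 2 * int n" "odd (i + j)" "s \<in> {-1, 1}" "t \<in> {-1, 1}"
  shows "celtic_rot n ((i, j), (i + s, j + t)) = ((i, j), (i + t, j - s))"
  by (subst celtic_rot_cases[OF refl assms(6,7)]) (use assms in auto)

lemma celtic_rot_row:
  assumes "i \<in> {0, 4}" "0 < j" "j < 2 * int n" "odd j" "s = (if i = 0 then 1 else -1)" "t \<in> {-1, 1}"
  shows "celtic_rot n ((i, j), (i + s, j + t)) = ((i, j), (i + s, j - t))"
  by (subst celtic_rot_cases[OF refl _ assms(6)]) (use assms in auto)

lemma celtic_rot_column:
  assumes "j \<in> {0, 2 * int n}" "i \<in> {1, 3}" "n \<ge> 1" "t = (if j = 0 then 1 else -1)" "s \<in> {-1, 1}"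
  shows "celtic_rot n ((i, j), (i + s, j + t)) = ((i, j), (i - s, j + t))"
  by (subst celtic_rot_cases[OF refl assms(5)]) (use assms in auto)

lemma darts_at_interior:
  assumes "0 < i" "i < 4" "0 < j" "j < 2 * int n" "odd (i + j)"
  shows "darts_at n (i, j) =
      {((i, j), (i - 1, j - 1)), ((i, j), (i - 1, j + 1)), ((i, j), (i + 1, j + 1)), ((i, j), (i + 1, j - 1))}"
    and "crossing (celtic n) ((i, j), (i - 1, j - 1)) ((i, j), (i - 1, j + 1))
      ((i, j), (i + 1, j + 1)) ((i, j), (i + 1, j - 1))"
proof -
  have "(i, j) \<in> celtic_points n" using assms by (intro celtic_pointsI) simp_all
  then show "darts_at n (i, j) =
      {((i, j), (i - 1, j - 1)), ((i, j), (i - 1, j + 1)), ((i, j), (i + 1, j + 1)), ((i, j), (i + 1, j - 1))}"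
    using assms(1-4) by (simp add: darts_at_eq insert_commute)
  note r = celtic_rot_interior[OF assms]
  show "crossing (celtic n) ((i, j), (i - 1, j - 1)) ((i, j), (i - 1, j + 1))
      ((i, j), (i + 1, j + 1)) ((i, j), (i + 1, j - 1))"
    using r[of "-1" "-1"] r[of "-1" 1] r[of 1 1] r[of 1 "-1"] by (simp add: crossing_def)
qed

lemma darts_at_row:
  assumes "i \<in> {0, 4}" "0 < j" "j < 2 * int n" "odd j"
  defines "s \<equiv> if i = 0 then 1 else -1"
  shows "darts_at n (i, j) = {((i, j), (i + s, j - 1)), ((i, j), (i + s, j + 1))}"
    and "bend (celtic n) ((i, j), (i + s, j - 1)) ((i, j), (i + s, j + 1))"
proof -
  have "(i, j) \<in> celtic_points n" using assms by (intro celtic_pointsI) auto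
  then show "darts_at n (i, j) = {((i, j), (i + s, j - 1)), ((i, j), (i + s, j + 1))}"
    using assms by (auto simp add: darts_at_eq insert_commute)
  note r = celtic_rot_row[OF assms(1-4) s_def[THEN meta_eq_to_obj_eq]]
  show "bend (celtic n) ((i, j), (i + s, j - 1)) ((i, j), (i + s, j + 1))"
    using r[of 1] r[of "-1"] by (simp add: bend_def)
qed

lemma darts_at_column:
  assumes "j \<in> {0, 2 * int n}" "i \<in> {1, 3}" "n \<ge> 1"
  defines "t \<equiv> if j = 0 then 1 else -1"
  shows "darts_at n (i, j) = {((i, j), (i - 1, j + t)), ((i, j), (i + 1, j + t))}"
    and "bend (celtic n) ((i, j), (i - 1, j + t)) ((i, j), (i + 1, j + t))"
proof -
  have "(i, j) \<in> celtic_points n" using assms by (intro celtic_pointsI) auto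
  then show "darts_at n (i, j) = {((i, j), (i - 1, j + t)), ((i, j), (i + 1, j + t))}"
    using assms by (auto simp add: darts_at_eq insert_commute)
  note r = celtic_rot_column[OF assms(1-3) t_def[THEN meta_eq_to_obj_eq]]
  show "bend (celtic n) ((i, j), (i - 1, j + t)) ((i, j), (i + 1, j + t))"
    using r[of 1] r[of "-1"] by (simp add: bend_def)
qed

lemma orbit_crossing:
  assumes "crossing D a b c d" "z \<in> {a, b, c, d}"
  shows "orbit (rot D) z = {a, b, c, d}"
  using assms orbit_4[of "rot D" a b c d] orbit_4[of "rot D" b c d a]
    orbit_4[of "rot D" c d a b] orbit_4[of "rot D" d a b c]
  by (auto simp: crossing_def)

lemma orbit_bend:
  assumes "bend D a b" "z \<in> {a, b}"
  shows "orbit (rot D) z = {a, b}"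
  using assms orbit_2[of "rot D" a b] orbit_2[of "rot D" b a]
  by (auto simp: bend_def)

text \<open>The bracket speaks of orbits of the rotation; this identifies them with grid locations,
  so that points can be removed column by column.\<close>

lemma orbit_celtic:
  assumes "n \<ge> 1" "u \<in> celtic_points n"
  shows "darts_at n u \<noteq> {}" and "z \<in> darts_at n u \<Longrightarrow> orbit (celtic_rot n) z = darts_at n u"
proof -
  obtain i j where u: "u = (i, j)" by fastforce
  have b: "0 \<le> i" "i \<le> 4" "0 \<le> j" "j \<le> 2 * int n" "odd (i + j)"
    using assms by (auto simp: celtic_points_def u)
  consider "0 < i" "i < 4" "0 < j" "j < 2 * int n" | "i \<in> {0, 4}" | "j \<in> {0, 2 * int n}" "i \<notin> {0, 4}"
    using b by force
  then have "darts_at n u \<noteq> {} \<and> (z \<in> darts_at n u \<longrightarrow> orbit (rot (celtic n)) z = darts_at n u)"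
  proof cases
    case 1
    note * = darts_at_interior[OF 1 b(5)]
    show ?thesis using orbit_crossing[OF *(2), of z] unfolding u *(1) by blast
  next
    case 2
    \<comment> \<open>Parity excludes the corners: on rows 0 and 4 the column is odd, hence strictly
      inside the even bounds.\<close>
    then have "odd j" using b(5) by auto
    moreover from this have "0 < j" "j < 2 * int n"
      using b(3,4) by (auto simp: order_less_le)
    ultimately have j: "0 < j" "j < 2 * int n" "odd j" by simp_all
    note * = darts_at_row[OF 2 j]
    show ?thesis using orbit_bend[OF *(2), of z] unfolding u *(1) by blast
  next
    case 3
    then have "odd i" using b(5) by auto
    then have "i \<noteq> 2" by auto
    then have "i \<in> {1, 3}" using b 3(2) by auto
    note * = darts_at_column[OF 3(1) this assms(1)]
    show ?thesis using orbit_bend[OF *(2), of z] unfolding u *(1) by blast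
  qed
  then show "darts_at n u \<noteq> {}" and "z \<in> darts_at n u \<Longrightarrow> orbit (celtic_rot n) z = darts_at n u"
    by simp_all
qed

lemma points_celtic:
  assumes "n \<ge> 1"
  shows "points (celtic n) = points_from n 0"
proof -
  have "orbit (celtic_rot n) d = darts_at n (fst d)" "fst d \<in> celtic_points n"
    if "d \<in> celtic_darts n" for d
  proof -
    show u: "fst d \<in> celtic_points n"
      using that by (auto simp: celtic_darts_def)
    show "orbit (celtic_rot n) d = darts_at n (fst d)"
      using orbit_celtic(2)[OF assms u] that by (simp add: darts_at_def)
  qed
  moreover have "\<exists>d\<in>celtic_darts n. fst d = u" if "u \<in> celtic_points n" for u
    using orbit_celtic(1)[OF assms that] unfolding darts_at_def by blast
  ultimately have "points (celtic n) = darts_at n ` celtic_points n"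
    unfolding points_def by (auto simp: image_iff) metis
  moreover have "{u \<in> celtic_points n. 0 \<le> snd u} = celtic_points n"
    by (auto simp: celtic_points_def)
  ultimately show ?thesis by (simp add: points_from_def)
qed

text \<open>Each dart records its location and no grid point is without darts, so different
  locations have different dart sets.\<close>

lemma darts_at_notin:
  assumes "n \<ge> 1" "u \<in> celtic_points n" "u \<notin> U"
  shows "darts_at n u \<notin> darts_at n ` U"
proof
  assume "darts_at n u \<in> darts_at n ` U"
  then obtain v where "v \<in> U" "darts_at n u = darts_at n v" by blast
  moreover obtain d where "d \<in> darts_at n u" using orbit_celtic(1)[OF assms(1,2)] by blast
  ultimately have "u \<in> U" by (auto simp: darts_at_def)
  with assms(3) show False by blast
qed

lemma celtic_points_column:
  "{u \<in> celtic_points n. m \<le> snd u} =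
    {(i, m) | i. (i, m) \<in> celtic_points n} \<union> {u \<in> celtic_points n. m + 1 \<le> snd u}"
proof (rule Set.set_eqI)
  fix u :: "int \<times> int"
  obtain i l where u: "u = (i, l)" by fastforce
  have "m \<le> l \<longleftrightarrow> l = m \<or> m + 1 \<le> l" by linarith
  then show "u \<in> {u \<in> celtic_points n. m \<le> snd u} \<longleftrightarrow>
    u \<in> {(i, m) | i. (i, m) \<in> celtic_points n} \<union> {u \<in> celtic_points n. m + 1 \<le> snd u}"
    unfolding u by auto
qed

lemma points_from_odd:
  assumes "odd m" "0 < m" "m < 2 * int n"
  shows "points_from n m =
    insert (darts_at n (0, m)) (insert (darts_at n (2, m)) (insert (darts_at n (4, m)) (points_from n (m + 1))))"
    and "darts_at n (0, m) \<notin> insert (darts_at n (2, m)) (insert (darts_at n (4, m)) (points_from n (m + 1)))"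
    and "darts_at n (2, m) \<notin> insert (darts_at n (4, m)) (points_from n (m + 1))"
    and "darts_at n (4, m) \<notin> points_from n (m + 1)"
proof -
  have n: "n \<ge> 1" using assms by linarith
  have "(i, m) \<in> celtic_points n \<longleftrightarrow> i = 0 \<or> i = 2 \<or> i = 4" for i
  proof -
    have "0 \<le> i \<and> i \<le> 4 \<and> even i \<longleftrightarrow> i = 0 \<or> i = 2 \<or> i = 4" by presburger
    then show ?thesis using assms by (auto simp: celtic_points_def)
  qed
  then have P: "(0, m) \<in> celtic_points n" "(2, m) \<in> celtic_points n" "(4, m) \<in> celtic_points n"
    and "{u \<in> celtic_points n. m \<le> snd u} =
      insert (0, m) (insert (2, m) (insert (4, m) {u \<in> celtic_points n. m + 1 \<le> snd u}))"
    by (simp_all, subst celtic_points_column, auto)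
  then show "points_from n m =
    insert (darts_at n (0, m)) (insert (darts_at n (2, m)) (insert (darts_at n (4, m)) (points_from n (m + 1))))"
    by (simp add: points_from_def)
  show "darts_at n (0, m) \<notin> insert (darts_at n (2, m)) (insert (darts_at n (4, m)) (points_from n (m + 1)))"
    using darts_at_notin[OF n P(1), of "insert (2, m) (insert (4, m) {u \<in> celtic_points n. m + 1 \<le> snd u})"]
    by (simp add: points_from_def)
  show "darts_at n (2, m) \<notin> insert (darts_at n (4, m)) (points_from n (m + 1))"
    using darts_at_notin[OF n P(2), of "insert (4, m) {u \<in> celtic_points n. m + 1 \<le> snd u}"]
    by (simp add: points_from_def)
  show "darts_at n (4, m) \<notin> points_from n (m + 1)"
    using darts_at_notin[OF n P(3), of "{u \<in> celtic_points n. m + 1 \<le> snd u}"]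
    by (simp add: points_from_def)
qed

lemma points_from_even:
  assumes "even m" "0 \<le> m" "m \<le> 2 * int n" "n \<ge> 1"
  shows "points_from n m = insert (darts_at n (1, m)) (insert (darts_at n (3, m)) (points_from n (m + 1)))"
    and "darts_at n (1, m) \<notin> insert (darts_at n (3, m)) (points_from n (m + 1))"
    and "darts_at n (3, m) \<notin> points_from n (m + 1)"
proof -
  have "(i, m) \<in> celtic_points n \<longleftrightarrow> i = 1 \<or> i = 3" for i
  proof -
    have "0 \<le> i \<and> i \<le> 4 \<and> odd i \<longleftrightarrow> i = 1 \<or> i = 3" by presburger
    then show ?thesis using assms by (auto simp: celtic_points_def)
  qed
  then have P: "(1, m) \<in> celtic_points n" "(3, m) \<in> celtic_points n"
    and "{u \<in> celtic_points n. m \<le> snd u} =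
      insert (1, m) (insert (3, m) {u \<in> celtic_points n. m + 1 \<le> snd u})"
    by (simp_all, subst celtic_points_column, auto)
  then show "points_from n m = insert (darts_at n (1, m)) (insert (darts_at n (3, m)) (points_from n (m + 1)))"
    by (simp add: points_from_def)
  show "darts_at n (1, m) \<notin> insert (darts_at n (3, m)) (points_from n (m + 1))"
    using darts_at_notin[OF assms(4) P(1), of "insert (3, m) {u \<in> celtic_points n. m + 1 \<le> snd u}"]
    by (simp add: points_from_def)
  show "darts_at n (3, m) \<notin> points_from n (m + 1)"
    using darts_at_notin[OF assms(4) P(2), of "{u \<in> celtic_points n. m + 1 \<le> snd u}"]
    by (simp add: points_from_def)
qed

lemma points_from_end: "points_from n (2 * int n + 1) = {}"
  by (auto simp: points_from_def celtic_points_def)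

section \<open>Diagonals indexed by their unit squares\<close>

lemma rightward_eq_iff [simp]: "rightward i j = rightward i' j' \<longleftrightarrow> i = i' \<and> j = j'"
  by (auto simp: rightward_def)

lemma rightward_neq_swap [simp]: "rightward i j \<noteq> prod.swap (rightward i' j')"
  by (auto simp: rightward_def)

lemma rightward_in_darts:
  "rightward i j \<in> celtic_darts n \<longleftrightarrow> 0 \<le> i \<and> i < 4 \<and> 0 \<le> j \<and> j < 2 * int n"
  by (auto simp: rightward_def celtic_darts_def celtic_points_def)

lemma swap_in_darts: "prod.swap d \<in> celtic_darts n \<longleftrightarrow> d \<in> celtic_darts n"
  by (auto simp: celtic_darts_def prod.swap_def split: prod.splits)

lemma celtic_dartE:
  assumes "d \<in> celtic_darts n"
  obtains i j where "0 \<le> i" "i < 4" "0 \<le> j" "j < 2 * int n"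
    "d = rightward i j \<or> d = prod.swap (rightward i j)"
proof -
  obtain i j s t where d: "d = ((i, j), (i + s, j + t))" "s \<in> {-1, 1}" "t \<in> {-1, 1}"
    "0 \<le> i" "i \<le> 4" "0 \<le> j" "j \<le> 2 * int n" "odd (i + j)"
    "0 \<le> i + s" "i + s \<le> 4" "0 \<le> j + t" "j + t \<le> 2 * int n"
    using assms by (rule celtic_dart_cases)
  show thesis
    \<comment> \<open>The minima give the top left corner of the square whose diagonal contains the
      dart.\<close>
    by (rule that[of "min i (i + s)" "min j (j + t)"])
      (use d in \<open>auto simp: rightward_def min_def\<close>)
qed

lemma leftward_eq_iff [simp]: "leftward i j = leftward i' j' \<longleftrightarrow> i = i' \<and> j = j'"
  unfolding leftward_def by (metis rightward_eq_iff swap_swap diff_add_cancel)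

lemma columns_rightward [simp]:
  "snd (fst (rightward i j)) = j" "snd (snd (rightward i j)) = j + 1"
  by (simp_all add: rightward_def)

lemma rightward_in_darts_from:
  "rightward i j \<in> darts_from n m \<longleftrightarrow> 0 \<le> i \<and> i < 4 \<and> 0 \<le> j \<and> m \<le> j \<and> j < 2 * int n"
  "prod.swap (rightward i j) \<in> darts_from n m \<longleftrightarrow> 0 \<le> i \<and> i < 4 \<and> 0 \<le> j \<and> m \<le> j \<and> j < 2 * int n"
  by (auto simp: darts_from_def rightward_in_darts swap_in_darts)

lemma rightward_image:
  "rightward i j \<in> (\<lambda>a. rightward (int a) m) ` {..<4} \<longleftrightarrow> j = m \<and> 0 \<le> i \<and> i < 4"
proof
  assume "j = m \<and> 0 \<le> i \<and> i < 4"
  then have "rightward i j = rightward (int (nat i)) m" "nat i \<in> {..<4}" by auto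
  then show "rightward i j \<in> (\<lambda>a. rightward (int a) m) ` {..<4}" by (rule image_eqI)
qed auto

lemma swap_mem_swap_image: "prod.swap d \<in> prod.swap ` A \<longleftrightarrow> d \<in> A"
  by (metis image_iff swap_swap)

text \<open>Smoothing column \<open>m\<close> consumes exactly the four diagonals of the squares
  between columns \<open>m\<close> and \<open>m + 1\<close>, each with both of its ends.\<close>

lemma darts_from_step:
  assumes "0 \<le> m"
  shows "darts_from n m - (\<lambda>a. rightward (int a) m) ` {..<4} - prod.swap ` (\<lambda>a. rightward (int a) m) ` {..<4} =
    darts_from n (m + 1)" (is "?L = _")
proof (rule Set.set_eqI)
  fix d
  show "d \<in> ?L \<longleftrightarrow> d \<in> darts_from n (m + 1)"
  proof (cases "d \<in> celtic_darts n")
    case True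
    then obtain i j where ij: "0 \<le> i" "i < 4" "0 \<le> j" "j < 2 * int n"
      and d: "d = rightward i j \<or> d = prod.swap (rightward i j)"
      by (rule celtic_dartE)
    have 1: "prod.swap (rightward i j) \<notin> (\<lambda>a. rightward (int a) m) ` {..<4}"
      by (auto dest: sym)
    have 2: "rightward i j \<notin> prod.swap ` (\<lambda>a. rightward (int a) m) ` {..<4}"
      by auto
    show ?thesis
      using d
    proof
      assume d: "d = rightward i j"
      show ?thesis
        using ij 2 unfolding d Diff_iff rightward_in_darts_from rightward_image by auto
    next
      assume d: "d = prod.swap (rightward i j)"
      show ?thesis
        using ij 1 unfolding d Diff_iff rightward_in_darts_from swap_mem_swap_image rightward_image by auto
    qed
  qed (auto simp: darts_from_def)
qed

text \<open>The darts of a crossing are listed clockwise from the upper left: upper strand, two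
  fresh arcs, lower strand. This is the order that \<open>weight_crossing\<close> expects.\<close>

lemma darts_at_odd:
  assumes "odd m" "0 < m" "m < 2 * int n"
  shows "darts_at n (0, m) = {leftward 0 m, rightward 0 m}"
    and "darts_at n (2, m) = {leftward 1 m, rightward 1 m, rightward 2 m, leftward 2 m}"
    and "darts_at n (4, m) = {leftward 3 m, rightward 3 m}"
    and "bend (celtic n) (leftward 0 m) (rightward 0 m)"
    and "crossing (celtic n) (leftward 1 m) (rightward 1 m) (rightward 2 m) (leftward 2 m)"
    and "bend (celtic n) (leftward 3 m) (rightward 3 m)"
  using assms darts_at_row[of 0 m n] darts_at_row[of 4 m n] darts_at_interior[of 2 m n]
  by (simp_all add: leftward_def rightward_def)

lemma darts_at_even:
  assumes "even m" "0 < m" "m < 2 * int n"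
  shows "darts_at n (1, m) = {leftward 0 m, rightward 0 m, rightward 1 m, leftward 1 m}"
    and "darts_at n (3, m) = {leftward 2 m, rightward 2 m, rightward 3 m, leftward 3 m}"
    and "crossing (celtic n) (leftward 0 m) (rightward 0 m) (rightward 1 m) (leftward 1 m)"
    and "crossing (celtic n) (leftward 2 m) (rightward 2 m) (rightward 3 m) (leftward 3 m)"
  using assms darts_at_interior[of 1 m n] darts_at_interior[of 3 m n]
  by (simp_all add: leftward_def rightward_def)

lemma darts_at_first:
  assumes "n \<ge> 1"
  shows "darts_at n (1, 0) = {rightward 0 0, rightward 1 0}"
    and "darts_at n (3, 0) = {rightward 2 0, rightward 3 0}"
    and "bend (celtic n) (rightward 0 0) (rightward 1 0)"
    and "bend (celtic n) (rightward 2 0) (rightward 3 0)"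
  using assms darts_at_column[of 0 n 1] darts_at_column[of 0 n 3]
  by (simp_all add: rightward_def)

lemma darts_at_last:
  assumes "n \<ge> 1"
  shows "darts_at n (1, 2 * int n) = {leftward 0 (2 * int n), leftward 1 (2 * int n)}"
    and "darts_at n (3, 2 * int n) = {leftward 2 (2 * int n), leftward 3 (2 * int n)}"
    and "bend (celtic n) (leftward 0 (2 * int n)) (leftward 1 (2 * int n))"
    and "bend (celtic n) (leftward 2 (2 * int n)) (leftward 3 (2 * int n))"
  using assms darts_at_column[of "2 * int n" n 1] darts_at_column[of "2 * int n" n 3]
  by (simp_all add: leftward_def rightward_def)

definition strand_weight ::
  "nat \<Rightarrow> 'a::comm_ring_1 \<Rightarrow> nat \<Rightarrow> int \<Rightarrow> (nat \<Rightarrow> nat) \<Rightarrow> 'a \<Rightarrow> bool" where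
  "strand_weight n x K m =
     weight (celtic n) x K (points_from n m) (\<lambda>a. leftward (int a) m) (darts_from n m)"

text \<open>The far ends of the right-pointing darts in column \<open>m\<close> are the
  left-pointing darts in column \<open>m + 1\<close>, so what remains after one column is the next
  cut.\<close>

lemma strand_weight_step:
  assumes "0 \<le> m" "strand_weight n x K (m + 1) \<pi> w"
  shows "weight (celtic n) x K (points_from n (m + 1)) (mate (celtic n) \<circ> (\<lambda>a. rightward (int a) m))
    (darts_from n m - (\<lambda>a. rightward (int a) m) ` {..<4} -
      mate (celtic n) ` (\<lambda>a. rightward (int a) m) ` {..<4}) \<pi> w"
  using assms(2) darts_from_step[OF assms(1), of n]
  by (simp add: strand_weight_def leftward_def comp_def)

lemma strand_weight_odd:
  assumes m: "odd m" "0 < m" "m < 2 * int n"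
    and a: "strand_weight n x K (m + 1) parallel a" and b: "strand_weight n x K (m + 1) nested b"
  shows "strand_weight n x (K + 4) m parallel (a + b)"
    and "strand_weight n x (K + 4) m nested ((1 + x) * b)"
proof -
  have m0: "0 \<le> m" using m by simp
  let ?F = "\<lambda>a::nat. leftward (int a) m" and ?g = "\<lambda>a::nat. rightward (int a) m"
  note eq = darts_at_odd(1-3)[OF m] and Q = points_from_odd[OF m]
  have eq': "darts_at n (0, m) = {?F 0, ?g 0}" "darts_at n (2, m) = {?F 1, ?g 1, ?g 2, ?F 2}"
    "darts_at n (4, m) = {?F 3, ?g 3}"
    using eq by simp_all
  have P: "bend (celtic n) (?F 0) (?g 0)" "crossing (celtic n) (?F 1) (?g 1) (?g 2) (?F 2)"
    "bend (celtic n) (?F 3) (?g 3)"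
    using darts_at_odd(4-6)[OF m] by simp_all
  have g: "\<And>a. a < 4 \<Longrightarrow> ?g a \<in> darts_from n m" "inj_on ?g {..<4}"
    "\<And>a b. a < 4 \<Longrightarrow> b < 4 \<Longrightarrow> ?g a \<noteq> mate (celtic n) (?g b)"
    using m by (auto simp: rightward_in_darts_from inj_on_def)
  note col = weight_odd_column[OF wf_celtic g P Q(2-4)[unfolded eq']
      strand_weight_step[OF m0 a] strand_weight_step[OF m0 b]]
  show "strand_weight n x (K + 4) m parallel (a + b)"
    unfolding strand_weight_def Q(1) eq' by (rule col(1))
  show "strand_weight n x (K + 4) m nested ((1 + x) * b)"
    unfolding strand_weight_def Q(1) eq' by (rule col(2))
qed

lemma strand_weight_even:
  assumes m: "even m" "0 < m" "m < 2 * int n"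
    and a: "strand_weight n x K (m + 1) parallel a" and b: "strand_weight n x K (m + 1) nested b"
  shows "strand_weight n x (K + 4) m parallel ((1 + x)\<^sup>2 * a)"
    and "strand_weight n x (K + 4) m nested (b + (2 + x) * a)"
proof -
  have m0: "0 \<le> m" "m \<le> 2 * int n" "n \<ge> 1" using m by simp_all
  let ?F = "\<lambda>a::nat. leftward (int a) m" and ?g = "\<lambda>a::nat. rightward (int a) m"
  note eq = darts_at_even(1,2)[OF m] and Q = points_from_even[OF m(1) m0]
  have eq': "darts_at n (1, m) = {?F 0, ?g 0, ?g 1, ?F 1}" "darts_at n (3, m) = {?F 2, ?g 2, ?g 3, ?F 3}"
    using eq by simp_all
  have P: "crossing (celtic n) (?F 0) (?g 0) (?g 1) (?F 1)" "crossing (celtic n) (?F 2) (?g 2) (?g 3) (?F 3)"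
    using darts_at_even(3,4)[OF m] by simp_all
  have g: "\<And>a. a < 4 \<Longrightarrow> ?g a \<in> darts_from n m" "inj_on ?g {..<4}"
    "\<And>a b. a < 4 \<Longrightarrow> b < 4 \<Longrightarrow> ?g a \<noteq> mate (celtic n) (?g b)"
    using m by (auto simp: rightward_in_darts_from inj_on_def)
  note col = weight_even_column[OF wf_celtic g P Q(2,3)[unfolded eq']
      strand_weight_step[OF m0(1) a] strand_weight_step[OF m0(1) b]]
  show "strand_weight n x (K + 4) m parallel ((1 + x)\<^sup>2 * a)"
    unfolding strand_weight_def Q(1) eq' by (rule col(1))
  show "strand_weight n x (K + 4) m nested (b + (2 + x) * a)"
    unfolding strand_weight_def Q(1) eq' by (rule col(2))
qed

lemma strand_weight_last:
  assumes "n \<ge> 1"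
  shows "strand_weight n x 1 (2 * int n) parallel x" and "strand_weight n x 1 (2 * int n) nested 1"
proof -
  let ?m = "2 * int n"
  let ?F = "\<lambda>a::nat. leftward (int a) ?m"
  have m: "even ?m" "0 \<le> ?m" "?m \<le> 2 * int n" by simp_all
  have eq: "darts_at n (1, ?m) = {?F 0, ?F 1}" "darts_at n (3, ?m) = {?F 2, ?F 3}"
    and P: "bend (celtic n) (?F 0) (?F 1)" "bend (celtic n) (?F 2) (?F 3)"
    using darts_at_last[OF assms] by simp_all
  have Q: "points_from n ?m = {{?F 0, ?F 1}, {?F 2, ?F 3}}"
    using points_from_even(1)[OF m assms] unfolding eq points_from_end .
  have ne: "{?F 0, ?F 1} \<noteq> {?F 2, ?F 3}"
    by (simp add: doubleton_eq_iff)
  show "strand_weight n x 1 ?m parallel x" "strand_weight n x 1 ?m nested 1"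
    unfolding strand_weight_def Q by (rule weight_end[OF wf_celtic P ne])+
qed

text \<open>
  The transfer matrix of an even column followed, from right to left, by an odd column; the odd
  column next to the right border accounts for the initial values. The first component belongs
  to \<open>parallel\<close>, the second to \<open>nested\<close>.
\<close>

fun strand_weights :: "'a::comm_ring_1 \<Rightarrow> nat \<Rightarrow> 'a \<times> 'a" where
  "strand_weights x 0 = (x + 1, x + 1)"
| "strand_weights x (Suc k) =
    (let (a, b) = strand_weights x k; a' = (1 + x)\<^sup>2 * a; b' = b + (2 + x) * a
     in (a' + b', (1 + x) * b'))"

text \<open>The deficit is \<open>8 * k + 5 = 1 + 4 * (2 * k + 1)\<close>: one for the right border
  and four fresh arcs for each of the \<open>2 * k + 1\<close> columns before it.\<close>

lemma strand_weight_celtic: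
  assumes "k < n"
  shows "strand_weight n x (8 * k + 5) (2 * int (n - k) - 1) parallel (fst (strand_weights x k)) \<and>
    strand_weight n x (8 * k + 5) (2 * int (n - k) - 1) nested (snd (strand_weights x k))"
  using assms
proof (induction k)
  case 0
  have m: "odd (2 * int n - 1)" "0 < 2 * int n - 1" "2 * int n - 1 < 2 * int n"
    using 0 by simp_all
  have n: "n \<ge> 1" using 0 by simp
  have "strand_weight n x 1 (2 * int n - 1 + 1) parallel x" "strand_weight n x 1 (2 * int n - 1 + 1) nested 1"
    using strand_weight_last[OF n, of x] by simp_all
  from strand_weight_odd[OF m this] show ?case
    by (simp add: add.commute)
next
  case (Suc k)
  obtain a b where ab: "strand_weights x k = (a, b)" by fastforce
  let ?m = "2 * int (n - Suc k)"
  have eq: "2 * int (n - k) - 1 = ?m + 1"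
    using Suc.prems by linarith
  have m: "even ?m" "0 < ?m" "?m < 2 * int n" "odd (?m - 1)" "0 < ?m - 1" "?m - 1 < 2 * int n"
    using Suc.prems by auto
  have "strand_weight n x (8 * k + 5) (?m + 1) parallel a" "strand_weight n x (8 * k + 5) (?m + 1) nested b"
    using Suc ab unfolding eq by simp_all
  note e = strand_weight_even[OF m(1-3) this]
  show ?case
    using strand_weight_odd[OF m(4-6), of x "8 * k + 5 + 4" "(1 + x)\<^sup>2 * a" "b + (2 + x) * a"] e ab
    by (simp add: Let_def)
qed

section \<open>The bracket polynomial\<close>

definition unsmoothed :: "('d, 'r) shadow_scheme \<Rightarrow> 'd rel" where
  "unsmoothed D = {(a, mate D a) | a. a \<in> darts D}\<^sup>*"

lemma unsmoothed_iff:
  assumes "wf_shadow D"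
  shows "(u, v) \<in> unsmoothed D \<longleftrightarrow> v = u \<or> u \<in> darts D \<and> v = mate D u"
proof
  assume "(u, v) \<in> unsmoothed D"
  then show "v = u \<or> u \<in> darts D \<and> v = mate D u"
    unfolding unsmoothed_def
    by (induction rule: rtrancl_induct) (use assms in \<open>auto simp: wf_shadow_def\<close>)
qed (auto simp: unsmoothed_def)

lemma equiv_unsmoothed:
  assumes "wf_shadow D"
  shows "equiv UNIV (unsmoothed D)"
proof (rule equivI)
  show "sym (unsmoothed D)"
    using assms by (auto simp: sym_def unsmoothed_iff wf_shadow_def)
  show "trans (unsmoothed D)"
    unfolding unsmoothed_def by (rule trans_rtrancl)
  show "refl (unsmoothed D)"
    unfolding unsmoothed_def by (rule refl_rtrancl)
qed simp

lemma state_sum_points: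
  "state_sum D x (unsmoothed D) (points D) = (\<Sum>S\<in>states D. x ^ card (circles D S))"
proof -
  have "joined D S = {(a, mate D a) | a. a \<in> darts D} \<union> (\<Union>P\<in>points D. \<Union>A\<in>S P. A \<times> A)" for S
    by (auto simp: joined_def)
  then show ?thesis
    unfolding unsmoothed_def state_sum_rtrancl
    by (simp add: state_sum_def states_def circles_def)
qed

text \<open>Before any smoothing a class is one diagonal, and \<open>?I\<close> lists the top left
  corners of the unit squares.\<close>

lemma card_unsmoothed_celtic:
  "card (celtic_darts n // unsmoothed (celtic n)) = 8 * n"
proof -
  let ?R = "unsmoothed (celtic n)" and ?I = "{0..<4} \<times> {0..<2 * int n}"
  let ?c = "\<lambda>(i, j). {rightward i j, prod.swap (rightward i j)}"
  have R: "?R `` {d} = {d, prod.swap d}" if "d \<in> celtic_darts n" for d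
    using that by (auto simp: unsmoothed_iff[OF wf_celtic])
  have "celtic_darts n // ?R = ?c ` ?I"
  proof (intro equalityI subsetI)
    fix C assume "C \<in> celtic_darts n // ?R"
    then obtain d where d: "d \<in> celtic_darts n" "C = {d, prod.swap d}"
      by (auto elim!: quotientE simp: R)
    from d(1) obtain i j where ij: "0 \<le> i" "i < 4" "0 \<le> j" "j < 2 * int n"
      and "d = rightward i j \<or> d = prod.swap (rightward i j)"
      by (rule celtic_dartE)
    then have "C = ?c (i, j)" using d(2) by auto
    then show "C \<in> ?c ` ?I" using ij by (intro image_eqI[of _ _ "(i, j)"]) simp_all
  next
    fix C assume "C \<in> ?c ` ?I"
    then obtain i j where ij: "0 \<le> i" "i < 4" "0 \<le> j" "j < 2 * int n" and C: "C = ?c (i, j)"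
      by auto
    then have "rightward i j \<in> celtic_darts n" by (simp add: rightward_in_darts)
    then show "C \<in> celtic_darts n // ?R"
      using C R by (auto intro!: quotientI simp: quotient_def)
  qed
  moreover have "inj_on ?c ?I"
    by (auto simp: inj_on_def doubleton_eq_iff)
  ultimately show ?thesis
    by (simp add: card_image)
qed

text \<open>No strands enter column 0, so the column rules cannot be applied there. Its two bends
  are smoothed directly; they create the four strands in pattern \<open>01|23\<close> and merge two
  pairs of diagonals.\<close>

lemma state_sum_celtic_start:
  assumes n: "n \<ge> 1"
  defines "R \<equiv> link (link (unsmoothed (celtic n)) (rightward 0 0) (rightward 1 0)) (rightward 2 0) (rightward 3 0)"
  shows "state_sum (celtic n) x (unsmoothed (celtic n)) (points_from n 0) =
      state_sum (celtic n) x R (points_from n 1)"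
    and "frontier (celtic n) (\<lambda>a. leftward (int a) 1) (darts_from n 1) parallel R"
    and "8 * n = card (celtic_darts n // R) + 2"
proof -
  let ?R0 = "unsmoothed (celtic n)"
  let ?R1 = "link ?R0 (rightward 0 0) (rightward 1 0)"
  note R0 = equiv_unsmoothed[OF wf_celtic[of n]]
  note R1 = equiv_link[OF R0, of "rightward 0 0" "rightward 1 0"]
  note iff0 = unsmoothed_iff[OF wf_celtic[of n]]
  note iff1 = link_iff[OF R0, of _ _ "rightward 0 0" "rightward 1 0"]
  note iff2 = link_iff[OF R1, of _ _ "rightward 2 0" "rightward 3 0", folded R_def]
  have m: "even (0::int)" "0 \<le> (0::int)" "0 \<le> 2 * int n" by simp_all
  note Q = points_from_even[OF m n] and at = darts_at_first[OF n]
  show "state_sum (celtic n) x ?R0 (points_from n 0) = state_sum (celtic n) x R (points_from n 1)"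
    using Q(2,3) at(3,4) unfolding Q(1) at(1,2) by (simp add: state_sum_bend R_def)
  have V: "rightward i 0 \<in> celtic_darts n" "prod.swap (rightward i 0) \<in> celtic_darts n"
    if "0 \<le> i" "i < 4" for i
    using that n by (simp_all add: rightward_in_darts swap_in_darts)
  have sw: "prod.swap (rightward i j) \<noteq> rightward i' j'" for i j i' j'
    by (metis rightward_neq_swap)
  have sw': "prod.swap a = prod.swap b \<longleftrightarrow> a = b" for a b :: grid_dart
    by (metis swap_swap)
  show "frontier (celtic n) (\<lambda>a. leftward (int a) 1) (darts_from n 1) parallel R"
    unfolding frontier_def
  proof (intro conjI ballI allI impI)
    show "equiv UNIV R" unfolding R_def by (rule equiv_link[OF R1])
    show "darts_from n 1 \<subseteq> darts (celtic n)" by (auto simp: darts_from_def)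
    fix d assume d: "d \<in> darts_from n 1"
    show "mate (celtic n) d \<in> darts_from n 1"
      using d by (simp add: darts_from_def swap_in_darts)
    have "1 \<le> snd (fst d)" "1 \<le> snd (fst (prod.swap d))"
      using d by (simp_all add: darts_from_def)
    then have d': "d \<noteq> rightward i 0" "prod.swap d \<noteq> rightward i 0" "d \<in> celtic_darts n" for i
      using d by (auto simp: darts_from_def simp del: fst_swap)
    have "(d, u) \<in> R \<longleftrightarrow> u = d \<or> u = prod.swap d" for u
      using d' d'(1,2)[THEN not_sym] by (simp add: iff2 iff1 iff0)
    then show "R `` {d} = {d, mate (celtic n) d}"
      by auto
  next
    fix a :: nat assume a: "a < 4"
    show "leftward (int a) 1 \<in> darts (celtic n) - darts_from n 1"
      using a V[of "int a"] by (simp add: leftward_def rightward_in_darts_from)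
    fix b :: nat assume b: "b < 4"
    show "(leftward (int a) 1, leftward (int b) 1) \<in> R \<longleftrightarrow> parallel a = parallel b"
      using a b
      by (elim less_4_cases; simp add: iff2 iff1 iff0 leftward_def V sw sw')
  qed
  have "(rightward 0 0, rightward 1 0) \<notin> ?R0" "(rightward 2 0, rightward 3 0) \<notin> ?R1"
    by (simp_all add: iff1 iff0)
  moreover note V[of 0] V[of 1] V[of 2] V[of 3]
  ultimately show "8 * n = card (celtic_darts n // R) + 2"
    using card_quotient_link[OF R0 finite_darts[OF wf_celtic], of "rightward 0 0" n "rightward 1 0"]
      card_quotient_link[OF R1 finite_darts[OF wf_celtic], of "rightward 2 0" n "rightward 3 0"]
    by (simp add: R_def card_unsmoothed_celtic)
qed

text \<open>After the left border \<open>8 * n - 2\<close> classes remain, one more than the deficit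
  of the other columns. Cancelling \<open>x ^ K\<close> in a domain therefore leaves a single factor
  \<open>x\<close>.\<close>

lemma state_sum_celtic:
  fixes x :: "'a::idom"
  assumes n: "n \<ge> 1" and x: "x \<noteq> 0"
  shows "(\<Sum>S\<in>states (celtic n). x ^ card (circles (celtic n) S)) = x * fst (strand_weights x (n - 1))"
proof -
  note start = state_sum_celtic_start(1)[OF n, of x] state_sum_celtic_start(2,3)[OF n]
  let ?Z = "\<Sum>S\<in>states (celtic n). x ^ card (circles (celtic n) S)"
  have "strand_weight n x (8 * (n - 1) + 5) (2 * int (n - (n - 1)) - 1) parallel
      (fst (strand_weights x (n - 1)))"
    using strand_weight_celtic[of "n - 1" n x] n by simp
  then have w: "strand_weight n x (8 * (n - 1) + 5) 1 parallel (fst (strand_weights x (n - 1)))"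
    using n by simp
  have "x ^ (8 * (n - 1) + 5) * ?Z = x ^ (8 * n - 2) * fst (strand_weights x (n - 1))"
    using w start n unfolding strand_weight_def weight_def
    by (simp add: state_sum_points[symmetric] points_celtic)
  also have "8 * n - 2 = (8 * (n - 1) + 5) + 1"
    using n by simp
  finally have "x ^ (8 * (n - 1) + 5) * ?Z = x ^ (8 * (n - 1) + 5) * (x * fst (strand_weights x (n - 1)))"
    by (simp only: power_add power_one_right mult.assoc)
  then show ?thesis using x by simp
qed

text \<open>Let \<open>M\<close> be the transfer matrix and \<open>v = (1, 1)\<close>. For
  \<open>r = q\<close> and \<open>r = - q\<close> the vector
  \<open>(x^2 + 2*x + 4 + r, x^2 + 4*x + 2 + r)\<close> is \<open>(2 M - p + r) v\<close>, an
  eigenvector for \<open>(p + r) / 2\<close> by Cayley-Hamilton. The two differ by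
  \<open>2 q v\<close>, and the initial value is \<open>(x + 1) v\<close>; hence the
  prefactor.\<close>

lemma strand_weights_closed_form:
  fixes x p q :: "'a::field_char_0"
  assumes p: "p = x^2 + 4*x + 4" and q: "q^2 = x^4 + 4*x^3 + 12*x^2 + 20*x + 12" and "q \<noteq> 0"
  shows "strand_weights x k =
    ((x + 1) / (2*q) * ((x^2 + 2*x + 4 + q) * ((p + q) / 2)^k - (x^2 + 2*x + 4 - q) * ((p - q) / 2)^k),
     (x + 1) / (2*q) * ((x^2 + 4*x + 2 + q) * ((p + q) / 2)^k - (x^2 + 4*x + 2 - q) * ((p - q) / 2)^k))"
proof (induction k)
  case 0
  show ?case using \<open>q \<noteq> 0\<close> by (simp add: field_simps)
next
  case (Suc k)
  define c where "c = (x + 1) / (2*q)"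
  define L M where "L = ((p + q) / 2)^k" and "M = ((p - q) / 2)^k"
  \<comment> \<open>The two components of the eigenvector equation. Only \<open>r^2\<close> is
    constrained, so both signs of \<open>q\<close> are covered.\<close>
  have step: "(1 + x)^2 * (x^2 + 2*x + 4 + r) + ((x^2 + 4*x + 2 + r) + (2 + x) * (x^2 + 2*x + 4 + r)) =
        (x^2 + 2*x + 4 + r) * ((p + r) / 2)"
      "(1 + x) * ((x^2 + 4*x + 2 + r) + (2 + x) * (x^2 + 2*x + 4 + r)) =
        (x^2 + 4*x + 2 + r) * ((p + r) / 2)" if r: "r^2 = q^2" for r
  proof -
    have r2: "r * r = x^4 + 4*x^3 + 12*x^2 + 20*x + 12"
      using r q by (simp add: power2_eq_square)
    \<comment> \<open>Doubling clears the denominator; the quartic split off by the expansion is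
      \<open>r * r\<close>, which permits the factorisation.\<close>
    have "2 * ((1 + x)^2 * (x^2 + 2*x + 4 + r) + ((x^2 + 4*x + 2 + r) + (2 + x) * (x^2 + 2*x + 4 + r))) =
        (x^2 + 2*x + 4) * p + (x^2 + 2*x + 4 + p) * r + (x^4 + 4*x^3 + 12*x^2 + 20*x + 12)"
      unfolding p by (simp add: algebra_simps power2_eq_square power3_eq_cube power4_eq_xxxx)
    also have "\<dots> = (x^2 + 2*x + 4 + r) * (p + r)"
      unfolding r2[symmetric] by (simp add: algebra_simps)
    finally show "(1 + x)^2 * (x^2 + 2*x + 4 + r) + ((x^2 + 4*x + 2 + r) + (2 + x) * (x^2 + 2*x + 4 + r)) =
        (x^2 + 2*x + 4 + r) * ((p + r) / 2)"
      by (simp add: field_simps)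
    have "2 * ((1 + x) * ((x^2 + 4*x + 2 + r) + (2 + x) * (x^2 + 2*x + 4 + r))) =
        (x^2 + 4*x + 2) * p + (x^2 + 4*x + 2 + p) * r + (x^4 + 4*x^3 + 12*x^2 + 20*x + 12)"
      unfolding p by (simp add: algebra_simps power2_eq_square power3_eq_cube power4_eq_xxxx)
    also have "\<dots> = (x^2 + 4*x + 2 + r) * (p + r)"
      unfolding r2[symmetric] by (simp add: algebra_simps)
    finally show "(1 + x) * ((x^2 + 4*x + 2 + r) + (2 + x) * (x^2 + 2*x + 4 + r)) =
        (x^2 + 4*x + 2 + r) * ((p + r) / 2)"
      by (simp add: field_simps)
  qed
  have s1: "(1 + x)^2 * (x^2 + 2*x + 4 - q) + ((x^2 + 4*x + 2 - q) + (2 + x) * (x^2 + 2*x + 4 - q)) =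
        (x^2 + 2*x + 4 - q) * ((p - q) / 2)"
    and s2: "(1 + x) * ((x^2 + 4*x + 2 - q) + (2 + x) * (x^2 + 2*x + 4 - q)) =
        (x^2 + 4*x + 2 - q) * ((p - q) / 2)"
    using step[of "- q"] by simp_all
  note t = step[of q, OF refl]
  have e1: "(1 + x)^2 * (c * ((x^2 + 2*x + 4 + q) * L - (x^2 + 2*x + 4 - q) * M)) +
      (c * ((x^2 + 4*x + 2 + q) * L - (x^2 + 4*x + 2 - q) * M) +
       (2 + x) * (c * ((x^2 + 2*x + 4 + q) * L - (x^2 + 2*x + 4 - q) * M))) =
      c * ((x^2 + 2*x + 4 + q) * ((p + q) / 2) * L - (x^2 + 2*x + 4 - q) * ((p - q) / 2) * M)"
    unfolding t(1)[symmetric] s1[symmetric] by (simp add: algebra_simps)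
  have e2: "(1 + x) * (c * ((x^2 + 4*x + 2 + q) * L - (x^2 + 4*x + 2 - q) * M) +
       (2 + x) * (c * ((x^2 + 2*x + 4 + q) * L - (x^2 + 2*x + 4 - q) * M))) =
      c * ((x^2 + 4*x + 2 + q) * ((p + q) / 2) * L - (x^2 + 4*x + 2 - q) * ((p - q) / 2) * M)"
    unfolding t(2)[symmetric] s2[symmetric] by (simp add: algebra_simps)
  show ?case
    unfolding strand_weights.simps Suc.IH Let_def prod.case c_def[symmetric] L_def[symmetric] M_def[symmetric]
      power_Suc e1 e2 by (simp only: mult.assoc)
qed

theorem theorem3p3:
  fixes n :: nat and x p q :: "rat poly fract alg_closure"
  assumes "n \<ge> 1"
    and "x = to_ac (to_fract [:0, 1:])"
    and "p = x^2 + 4*x + 4"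
    and "q^2 = x^4 + 4*x^3 + 12*x^2 + 20*x + 12"
  shows "to_ac (to_fract (map_poly of_int (bracket (celtic n)))) =
    1 / (2*q) * (x^2 + x) *
      ((x^2 + 2*x + 4 + q) * ((p + q) / 2)^(n - 1) -
       (x^2 + 2*x + 4 - q) * ((p - q) / 2)^(n - 1))"
proof -
  have hom_power: "to_fract (a ^ k) = to_fract a ^ k" for a :: "rat poly" and k
    by (induction k) simp_all
  have hom_of_nat: "to_fract (of_nat k) = of_nat k" for k
    by (induction k) simp_all
  have hom_numeral: "to_fract (numeral m) = numeral m" for m
    using hom_of_nat[of "numeral m"] by simp
  have x0: "x \<noteq> 0" unfolding assms(2) by simp
  have "q^2 = to_ac (to_fract ([:0, 1:]^4 + 4*[:0, 1:]^3 + 12*[:0, 1:]^2 + 20*[:0, 1:] + 12))"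
    unfolding assms(2,4) by (simp only: to_ac_add to_ac_mult to_ac_power to_ac_numeral
        to_fract_add to_fract_mult hom_power hom_numeral)
  moreover have "[:0, 1:]^4 + 4*[:0, 1:]^3 + 12*[:0, 1:]^2 + 20*[:0, 1:] + 12 = ([:12, 20, 12, 4, 1:] :: rat poly)"
    by (simp add: power2_eq_square power3_eq_cube power4_eq_xxxx numeral_poly)
  ultimately have "q^2 = to_ac (to_fract [:12, 20, 12, 4, 1:])" by (simp only:)
  \<comment> \<open>Division by \<open>2*q\<close> is meaningful only for nonzero \<open>q\<close>,
    and this holds because \<open>q^2\<close> is the image of a nonzero polynomial.\<close>
  then have q0: "q \<noteq> 0" by auto
  have map_sum: "map_poly rat_of_int (sum f A) = (\<Sum>a\<in>A. map_poly of_int (f a))" for f :: "'b \<Rightarrow> int poly" and A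
    by (rule poly_eqI) (simp add: coeff_map_poly coeff_sum)
  have "monom 1 k = ([:0, 1:] :: rat poly) ^ k" for k
    by (simp add: monom_altdef)
  then have "to_ac (to_fract (map_poly of_int (bracket (celtic n)))) =
      (\<Sum>S\<in>states (celtic n). x ^ card (circles (celtic n) S))"
    unfolding bracket_def map_sum to_fract_sum to_ac_sum assms(2)
    by (simp add: map_poly_monom hom_power)
  also have "\<dots> = x * fst (strand_weights x (n - 1))"
    by (rule state_sum_celtic[OF assms(1) x0])
  also have "\<dots> = 1 / (2*q) * (x^2 + x) *
      ((x^2 + 2*x + 4 + q) * ((p + q) / 2)^(n - 1) -
       (x^2 + 2*x + 4 - q) * ((p - q) / 2)^(n - 1))"
    unfolding strand_weights_closed_form[OF assms(3,4) q0]
    by (simp add: power2_eq_square algebra_simps)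
  finally show ?thesis .
qed

end
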